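(* Let $A$ be a linear operator on a Banach space $X$ satisfying the resolvent condition and the forcing condition, and let $\{B(t)\}_{t\in\mathbb R}\subset\mathcal L(X_0,X)$ satisfy the perturbation condition with bound function $b$. Assume in addition that $\sup_{t\in\mathbb R}b(t)<+\infty$. Then the following assertions are equivalent: i) The evolution family $\{U_B(t,s)\}_{(t,s)\in\Delta}$ has an exponential dichotomy. ii) For each $f\in BC(\mathbb R,X)$ there exists a unique integrated solution $u\in BC(\mathbb R,X_0)$ of $\frac{du(t)}{dt}=(A+B(t))u(t)+f(t)$, $t\in\mathbb R$.
   Context: $(X,\|\cdot\|)$ is a Banach space, $A:D(A)\subset X\to X$ is a linear operator (its domain need not be dense), $X_0:=\overline{D(A)}$ with the norm of $X$, $\rho(A)$ is the resolvent set, $R_\lambda(A):=(\lambda I-A)^{-1}$, and $\Delta:=\{(t,s)\in\mathbb R^2:t\ge s\}$. $BC(\mathbb R,Z)$ is the space of bounded continuous functions from $\mathbb R$ to $Z$. Resolvent condition: there are fixed $\omega\in\mathbb R$, $M\ge1$ with $(\omega,+\infty)\subset\rho(A)$, $\|(\lambda I-A)^{-k}\|_{\mathcal L(X_0)}\le M(\lambda-\omega)^{-k}$ for all $\lambda>\omega$, $k\ge1$, and $\lim_{\lambda\to+\infty}(\lambda I-A)^{-1}x=0$ for all $x\in X$. Forcing condition: for each $\tau>0$ and $f\in C([0,\tau],X)$ there is $u_f\in C([0,\tau],X_0)$ with $\int_0^tu_f(s)ds\in D(A)$ and $u_f(t)=A\int_0^tu_f(s)ds+\int_0^tf(s)ds$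 for all $t\in[0,\tau]$; moreover there is a non decreasing $\delta:[0,+\infty)\to[0,+\infty)$ (independent of $f,\tau$) with $\delta(t)\to0$ as $t\to0^+$ and $\|u_f(t)\|\le\delta(t)\sup_{s\in[0,t]}\|f(s)\|$. Perturbation condition: $B(t)\in\mathcal L(X_0,X)$ for $t\in\mathbb R$, $t\mapsto B(t)x$ is continuous from $\mathbb R$ into $X$ for each $x\in X_0$, and there is $b\in C(\mathbb R,\mathbb R_+)$ with $\|B(t)\|_{\mathcal L(X_0,X)}\le b(t)$ for all $t\in\mathbb R$. Integrated solution on $\mathbb R$ of $u'=(A+B(t))u+f$: a function $u\in C(\mathbb R,X_0)$ such that for all $t\ge t_0$ in $\mathbb R$: $\int_{t_0}^tu(r)dr\in D(A)$ and $u(t)=u(t_0)+A\int_{t_0}^tu(r)dr+\int_{t_0}^t[B(r)u(r)+f(r)]dr$. Integrated solutions on $[t_0,+\infty)$ with initial value $x\in X_0$ are defined by the same relations for the fixed $t_0$ and all $t\ge t_0$, with $u(t_0)=x$. An evolution family on a Banach space $Z$ is $\{U(t,s)\}_{(t,s)\in\Delta}\subset\mathcal L(Z)$ with $U(t,t)=I$, $U(t,r)U(r,s)=U(t,s)$ for $t\ge r\ge s$, and $(t,s)\mapsto U(t,s)x$ continuous on $\Delta$ for each $x\in Z$. $\{U_B(t,s)\}_{(t,s)\in\Delta}\subset\mathcal L(X_0)$ is the evolution family such that $t\mapsto U_B(t,t_0)x_0$ is the unique integrated solution on $[t_0,+\infty)$ of $u'=(A+B(t))u$, $u(t_0)=x_0\in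 X_0$. Exponential dichotomy: an evolution family $U$ on $Z$ has an exponential dichotomy with constant $\kappa\ge1$ and exponent $\beta>0$ if: (i) there are families of bounded projections $\{\Pi^\pm(t)\}_{t\in\mathbb R}$ on $Z$, with $t\mapsto\Pi^\pm(t)x$ continuous for each $x\in Z$ and $\Pi^+(t)+\Pi^-(t)=I$; put $U^\pm(t,s):=U(t,s)\Pi^\pm(s)$ for $t\ge s$; (ii) $\Pi^+(t)U(t,s)=U(t,s)\Pi^+(s)$ for $t\ge s$ (hence the same for $\Pi^-$); (iii) for $t\ge s$, $U(t,s)$ restricted to $\Pi^-(s)(Z)$ is invertible onto $\Pi^-(t)(Z)$, with inverse $\bar U^-(s,t)$; put $U^-(s,t):=\bar U^-(s,t)\Pi^-(t)$; (iv) $\|U^+(t,s)\|\le\kappa e^{-\beta(t-s)}$ and $\|U^-(s,t)\|\le\kappa e^{-\beta(t-s)}$ for all $t\ge s$. "Has an exponential dichotomy" means for some $\kappa\ge1$, $\beta>0$. *)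

theory Defs
  imports "HOL-Analysis.Analysis"
begin

text \<open>
  An unbounded operator is a pair of its domain \<open>D\<close> and a total function \<open>A\<close> whose values outside
  \<open>D\<close> are irrelevant. The space \<open>X\<^sub>0\<close> is the set \<open>closure D\<close>, and bounded operators between
  subspaces are total functions of which only the restriction to the subspace matters. All spaces
  are over the reals.
\<close>

definition linear_operator_on :: "'a::real_vector set \<Rightarrow> ('a \<Rightarrow> 'b::real_vector) \<Rightarrow> bool" where
  "linear_operator_on D A \<longleftrightarrow> subspace D \<and>
     (\<forall>x\<in>D. \<forall>y\<in>D. A (x + y) = A x + A y) \<and> (\<forall>c. \<forall>x\<in>D. A (c *\<^sub>R x) = c *\<^sub>R A x)"

text \<open>For \<open>c \<ge> 0\<close> this says that the operator norm of the restriction of \<open>T\<close> to \<open>Y\<close> is at most \<open>c\<close>.\<close>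

definition opnorm_le :: "'a::real_normed_vector set \<Rightarrow> ('a \<Rightarrow> 'b::real_normed_vector) \<Rightarrow> real \<Rightarrow> bool"
  where "opnorm_le Y T c \<longleftrightarrow> (\<forall>x\<in>Y. norm (T x) \<le> c * norm x)"

definition bounded_operators ::
    "'a::real_normed_vector set \<Rightarrow> 'b::real_normed_vector set \<Rightarrow> ('a \<Rightarrow> 'b) set" where
  "bounded_operators Y Z = {T. linear_operator_on Y T \<and> T ` Y \<subseteq> Z \<and> (\<exists>c. opnorm_le Y T c)}"

definition resolvent :: "'a::real_normed_vector set \<Rightarrow> ('a \<Rightarrow> 'a) \<Rightarrow> real \<Rightarrow> 'a \<Rightarrow> 'a" where
  "resolvent D A l = inv_into D (\<lambda>x. l *\<^sub>R x - A x)"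

definition resolvent_set :: "'a::real_normed_vector set \<Rightarrow> ('a \<Rightarrow> 'a) \<Rightarrow> real set" where
  "resolvent_set D A =
     {l. bij_betw (\<lambda>x. l *\<^sub>R x - A x) D UNIV \<and> bounded_linear (resolvent D A l)}"

definition resolvent_condition :: "'a::real_normed_vector set \<Rightarrow> ('a \<Rightarrow> 'a) \<Rightarrow> bool" where
  "resolvent_condition D A \<longleftrightarrow>
     (\<exists>w M. M \<ge> 1 \<and> {w<..} \<subseteq> resolvent_set D A \<and>
        (\<forall>l>w. \<forall>k\<ge>1. opnorm_le (closure D) (resolvent D A l ^^ k) (M / (l - w) ^ k))) \<and>
     (\<forall>x. ((\<lambda>l. resolvent D A l x) \<longlongrightarrow> 0) at_top)"

definition forcing_condition :: "'a::banach set \<Rightarrow> ('a \<Rightarrow> 'a) \<Rightarrow> bool" where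
  "forcing_condition D A \<longleftrightarrow>
     (\<exists>\<delta>::real \<Rightarrow> real. mono_on {0..} \<delta> \<and> (\<forall>t\<ge>0. \<delta> t \<ge> 0) \<and> (\<delta> \<longlongrightarrow> 0) (at_right 0) \<and>
       (\<forall>\<tau>>0. \<forall>f. continuous_on {0..\<tau>} f \<longrightarrow>
         (\<exists>u. continuous_on {0..\<tau>} u \<and> u ` {0..\<tau>} \<subseteq> closure D \<and>
           (\<forall>t\<in>{0..\<tau>}. integral {0..t} u \<in> D \<and>
              u t = A (integral {0..t} u) + integral {0..t} f \<and>
              norm (u t) \<le> \<delta> t * (SUP s\<in>{0..t}. norm (f s))))))"

definition perturbation_condition ::
    "'a::real_normed_vector set \<Rightarrow> (real \<Rightarrow> 'a \<Rightarrow> 'a) \<Rightarrow> (real \<Rightarrow> real) \<Rightarrow> bool" where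
  "perturbation_condition X0 B b \<longleftrightarrow>
     (\<forall>t. B t \<in> bounded_operators X0 UNIV) \<and>
     (\<forall>x\<in>X0. continuous_on UNIV (\<lambda>t. B t x)) \<and>
     continuous_on UNIV b \<and> (\<forall>t. b t \<ge> 0) \<and> (\<forall>t. opnorm_le X0 (B t) (b t))"

text \<open>Integrated solutions of \<open>u' = (A + B(t)) u + f\<close> on \<open>[t\<^sub>0, \<infinity>)\<close> and on the whole line.\<close>

definition integrated_relations ::
    "'a::banach set \<Rightarrow> ('a \<Rightarrow> 'a) \<Rightarrow> (real \<Rightarrow> 'a \<Rightarrow> 'a) \<Rightarrow> (real \<Rightarrow> 'a) \<Rightarrow> real \<Rightarrow> (real \<Rightarrow> 'a) \<Rightarrow> bool" where
  "integrated_relations D A B f t0 u \<longleftrightarrow>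
     (\<forall>t\<ge>t0. integral {t0..t} u \<in> D \<and>
        u t = u t0 + A (integral {t0..t} u) + integral {t0..t} (\<lambda>r. B r (u r) + f r))"

definition integrated_solution_from ::
    "'a::banach set \<Rightarrow> ('a \<Rightarrow> 'a) \<Rightarrow> (real \<Rightarrow> 'a \<Rightarrow> 'a) \<Rightarrow> (real \<Rightarrow> 'a) \<Rightarrow> real \<Rightarrow> 'a \<Rightarrow> (real \<Rightarrow> 'a) \<Rightarrow> bool" where
  "integrated_solution_from D A B f t0 x u \<longleftrightarrow>
     continuous_on {t0..} u \<and> u ` {t0..} \<subseteq> closure D \<and> u t0 = x \<and> integrated_relations D A B f t0 u"

definition integrated_solution ::
    "'a::banach set \<Rightarrow> ('a \<Rightarrow> 'a) \<Rightarrow> (real \<Rightarrow> 'a \<Rightarrow> 'a) \<Rightarrow> (real \<Rightarrow> 'a) \<Rightarrow> (real \<Rightarrow> 'a) \<Rightarrow> bool" where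
  "integrated_solution D A B f u \<longleftrightarrow>
     continuous_on UNIV u \<and> range u \<subseteq> closure D \<and> (\<forall>t0. integrated_relations D A B f t0 u)"

definition evolution_family ::
    "'a::real_normed_vector set \<Rightarrow> (real \<Rightarrow> real \<Rightarrow> 'a \<Rightarrow> 'a) \<Rightarrow> bool" where
  "evolution_family Z U \<longleftrightarrow>
     (\<forall>t s. t \<ge> s \<longrightarrow> U t s \<in> bounded_operators Z Z) \<and>
     (\<forall>t. \<forall>x\<in>Z. U t t x = x) \<and>
     (\<forall>t r s. t \<ge> r \<and> r \<ge> s \<longrightarrow> (\<forall>x\<in>Z. U t r (U r s x) = U t s x)) \<and>
     (\<forall>x\<in>Z. continuous_on {(t, s). t \<ge> s} (\<lambda>(t, s). U t s x))"

text \<open>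
  \<open>U\<close> is the evolution family \<open>U\<^sub>B\<close> on \<open>X\<^sub>0\<close>. This determines \<open>U t s x\<close> for \<open>t \<ge> s\<close> and
  \<open>x \<in> X\<^sub>0\<close>, and nothing else about \<open>U\<close> is ever used.
\<close>

definition is_evolution_family_of ::
    "'a::banach set \<Rightarrow> ('a \<Rightarrow> 'a) \<Rightarrow> (real \<Rightarrow> 'a \<Rightarrow> 'a) \<Rightarrow> (real \<Rightarrow> real \<Rightarrow> 'a \<Rightarrow> 'a) \<Rightarrow> bool" where
  "is_evolution_family_of D A B U \<longleftrightarrow>
     evolution_family (closure D) U \<and>
     (\<forall>t0. \<forall>x\<in>closure D.
        integrated_solution_from D A B (\<lambda>_. 0) t0 x (\<lambda>t. U t t0 x) \<and>
        (\<forall>v. integrated_solution_from D A B (\<lambda>_. 0) t0 x v \<longrightarrow> (\<forall>t\<ge>t0. v t = U t t0 x)))"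

definition bounded_projection :: "'a::real_normed_vector set \<Rightarrow> ('a \<Rightarrow> 'a) \<Rightarrow> bool" where
  "bounded_projection Z P \<longleftrightarrow> P \<in> bounded_operators Z Z \<and> (\<forall>x\<in>Z. P (P x) = P x)"

text \<open>
  \<open>Pp\<close> and \<open>Pm\<close> are the families \<open>\<Pi>\<^sup>+\<close> and \<open>\<Pi>\<^sup>-\<close>. The operator \<open>U\<^sup>-(s,t)\<close> is
  \<open>inv_into (Pm s ` Z) (U t s) \<circ> Pm t\<close>, and \<open>U\<^sup>+(t,s)\<close> is \<open>U t s \<circ> Pp s\<close>.
\<close>

definition exponential_dichotomy_with ::
    "'a::real_normed_vector set \<Rightarrow> (real \<Rightarrow> real \<Rightarrow> 'a \<Rightarrow> 'a) \<Rightarrow> real \<Rightarrow> real \<Rightarrow> bool" where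
  "exponential_dichotomy_with Z U \<kappa> \<beta> \<longleftrightarrow>
     (\<exists>Pp Pm :: real \<Rightarrow> 'a \<Rightarrow> 'a.
        (\<forall>t. bounded_projection Z (Pp t) \<and> bounded_projection Z (Pm t)) \<and>
        (\<forall>x\<in>Z. continuous_on UNIV (\<lambda>t. Pp t x) \<and> continuous_on UNIV (\<lambda>t. Pm t x)) \<and>
        (\<forall>t. \<forall>x\<in>Z. Pp t x + Pm t x = x) \<and>
        (\<forall>t s. t \<ge> s \<longrightarrow> (\<forall>x\<in>Z. Pp t (U t s x) = U t s (Pp s x))) \<and>
        (\<forall>t s. t \<ge> s \<longrightarrow> bij_betw (U t s) (Pm s ` Z) (Pm t ` Z)) \<and>
        (\<forall>t s. t \<ge> s \<longrightarrow>
           opnorm_le Z (U t s \<circ> Pp s) (\<kappa> * exp (- \<beta> * (t - s))) \<and>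
           opnorm_le Z (inv_into (Pm s ` Z) (U t s) \<circ> Pm t) (\<kappa> * exp (- \<beta> * (t - s)))))"

definition has_exponential_dichotomy ::
    "'a::real_normed_vector set \<Rightarrow> (real \<Rightarrow> real \<Rightarrow> 'a \<Rightarrow> 'a) \<Rightarrow> bool" where
  "has_exponential_dichotomy Z U \<longleftrightarrow> (\<exists>\<kappa>\<ge>1. \<exists>\<beta>>0. exponential_dichotomy_with Z U \<kappa> \<beta>)"

end

theory Submission
  imports Defs
begin

text \<open>
  With \<open>R = (l I - A)\<^sup>-\<^sup>1\<close> for one \<open>l\<close> in the resolvent set, integrated solutions are the solutions
  of a linear equation with bounded operators only. Solutions with zero initial value and forcing
  term in \<open>X\<close> exist on intervals of a fixed length \<open>h\<close> by a Neumann series in the forcing operator,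
  and concatenating them with \<open>U\<^sub>B\<close> gives all solutions. Comparing \<open>U\<^sub>B(\<cdot>, s)\<close> with the translate of
  \<open>U\<^sub>B(\<cdot>, 0)\<close> bounds \<open>U\<^sub>B(t, s)\<close> uniformly for \<open>s \<le> t \<le> s + h\<close>.

  Given a dichotomy, the bounded solution is the sum over the grid \<open>h \<int>\<close> of the increments of the local
  forced solutions, propagated by \<open>U\<^sup>+\<close> into the future and by \<open>U\<^sup>-\<close> into the past. Conversely,
  admissibility gives a bounded operator \<open>f \<mapsto> u\<close>. Let \<open>u\<close> be the bounded solution for the
  forcing term \<open>\<phi>(r - t) U\<^sub>B(r, t) x\<close>, where \<open>\<phi>\<close> is a bump on \<open>[0, h]\<close> of integral 1. Then
  \<open>- u(t)\<close> has a bounded backward orbit and \<open>x + u(t)\<close> a bounded forward orbit, which yields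
  \<open>\<Pi>\<^sup>- x\<close> and \<open>\<Pi>\<^sup>+ x\<close>. Exponential decay follows by multiplying \<open>u\<close> with an exponential weight,
  which perturbs the equation only by a small multiple of \<open>u\<close>.
\<close>

subsection \<open>Countably subadditive seminorms\<close>

text \<open>The forcing term and the values of \<open>B t\<close> lie in the whole space, while
  \<open>U_B\<close> acts on the closure of the domain only. Propagating \<open>f(s)\<close> by
  \<open>U_B(t, s)\<close>, as in the variation of constants formula, therefore has no meaning.
  Whatever is propagated must first be brought into \<open>X0\<close>: by taking end values of
  solutions started at 0, or by choosing forcing terms that are multiples of orbits of
  \<open>U_B\<close> itself.

  Strong continuity of \<open>U_B\<close> controls compact sets of times only, whereas both
  directions need constants uniform along the line. The finite supremum of \<open>b\<close> supplies
  them: together with the smallness of \<open>\<delta>\<close> near 0 it fixes one step length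
  \<open>h\<close> for all initial times.

  The exponent of the dichotomy comes from a bound \<open>K\<close> for the solution operator: an
  exponential weight of rate at most \<open>1 / (2 * K)\<close> can still be absorbed.

  The space \<open>X0\<close> is a subset of a type and not a type, so the Banach space principles
  are derived for a seminorm on a closed subspace.\<close>

text \<open>Zabreiko's lemma, from which uniform boundedness and the closed graph theorem both follow.\<close>

lemma bounded_of_countably_subadditive:
  fixes Z :: "'a::banach set" and p :: "'a \<Rightarrow> real"
  assumes Z: "subspace Z" "closed Z"
    and nonneg: "\<And>x. x \<in> Z \<Longrightarrow> 0 \<le> p x"
    and homog: "\<And>c x. x \<in> Z \<Longrightarrow> p (c *\<^sub>R x) \<le> \<bar>c\<bar> * p x"
    and subadd: "\<And>X. range X \<subseteq> Z \<Longrightarrow> summable (\<lambda>n. norm (X n)) \<Longrightarrow> summable (\<lambda>n. p (X n))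
      \<Longrightarrow> p (suminf X) \<le> (\<Sum>n. p (X n))"
  obtains C where "C \<ge> 0" "\<And>x. x \<in> Z \<Longrightarrow> p x \<le> C * norm x"
proof -
  define S where "S n = {x\<in>Z. p x \<le> real n}" for n
  have p0: "p 0 = 0"
    using homog[of 0 0] nonneg[of 0] subspace_0[OF Z(1)] by simp
  have SZ: "S n \<subseteq> Z" for n
    by (auto simp: S_def)
  have clZ: "closure (S n) \<subseteq> Z" for n
    using SZ Z(2) by (simp add: closure_minimal)
  have tri: "p (x + y) \<le> p x + p y" if "x \<in> Z" "y \<in> Z" for x y
  proof -
    define X where "X n = (if n = 0 then x else if n = 1 then y else 0)" for n :: nat
    have X: "(\<lambda>n. f (X n)) sums (f x + f y)" if "f 0 = 0" for f :: "'a \<Rightarrow> 'b::real_normed_vector"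
    proof -
      have "(\<lambda>n. f (X n)) sums (\<Sum>n\<in>{0,1}. f (X n))"
        by (rule sums_finite) (auto simp: X_def that)
      then show ?thesis by (simp add: X_def)
    qed
    have "range X \<subseteq> Z"
      using that subspace_0[OF Z(1)] by (auto simp: X_def)
    from subadd[OF this] X[of norm] X[of p] X[of "\<lambda>x. x"] p0 show ?thesis
      by (simp add: sums_iff)
  qed
  \<comment> \<open>Baire's theorem is applied inside \<open>Z\<close>, with relative interiors,
    since \<open>Z\<close> may have empty interior in the whole space.\<close>
  have "\<exists>n. top_of_set Z interior_of closure (S n) \<noteq> {}"
  proof (rule ccontr)
    assume *: "\<nexists>n. top_of_set Z interior_of closure (S n) \<noteq> {}"
    have "completely_metrizable_space (top_of_set Z)"
      by (rule completely_metrizable_space_closedin[OF completely_metrizable_space_euclidean])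
        (use Z(2) in simp)
    then have "top_of_set Z interior_of \<Union>(range (\<lambda>n. closure (S n))) = {}"
    proof (rule Baire_category_alt[OF disjI1])
      fix T assume "T \<in> range (\<lambda>n. closure (S n))"
      then obtain n where "T = closure (S n)" by blast
      then show "closedin (top_of_set Z) T \<and> top_of_set Z interior_of T = {}"
        using * clZ[of n] by (simp add: closedin_closed_eq[OF Z(2)])
    qed simp
    moreover have "\<Union>(range (\<lambda>n. closure (S n))) = Z"
    proof -
      have "x \<in> (\<Union>n. S n)" if "x \<in> Z" for x
        using that real_arch_simple[of "p x"] by (auto simp: S_def)
      then have "Z \<subseteq> (\<Union>n. S n)" by blast
      also have "\<dots> \<subseteq> (\<Union>n. closure (S n))" by (intro UN_mono order_refl closure_subset)
      finally show ?thesis using clZ by (intro equalityI UN_least)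
    qed
    ultimately show False
      using interior_of_topspace[of "top_of_set Z"] subspace_0[OF Z(1)]
      by (metis empty_iff topspace_euclidean_subtopology)
  qed
  then obtain n x0 e where e: "e > 0" and x0: "x0 \<in> Z" "\<And>x. x \<in> Z \<Longrightarrow> dist x x0 < e \<Longrightarrow> x \<in> closure (S n)"
  proof -
    obtain n x0 T where T: "openin (top_of_set Z) T" "x0 \<in> T" "T \<subseteq> closure (S n)"
      using \<open>\<exists>n. top_of_set Z interior_of closure (S n) \<noteq> {}\<close> unfolding interior_of_def by blast
    then show ?thesis using that unfolding openin_euclidean_subtopology_iff by blast
  qed
  have neg: "- x \<in> closure (S n)" if "x \<in> closure (S n)" for x
  proof -
    from that obtain f where f: "\<And>k. f k \<in> S n" "f \<longlonglongrightarrow> x" by (auto simp: closure_sequential)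
    have "- f k \<in> S n" for k
      using f(1)[of k] homog[of "f k" "-1"] subspace_neg[OF Z(1)] by (auto simp: S_def)
    then show ?thesis unfolding closure_sequential
      by (intro exI[of _ "\<lambda>k. - f k"]) (auto intro!: tendsto_intros f(2))
  qed
  \<comment> \<open>\<open>y\<close> is the midpoint of \<open>x0 + y\<close> and
    \<open>y - x0\<close>. As the closure of \<open>S n\<close> is symmetric and closed under
    midpoints, the ball around \<open>x0\<close> moves to the origin.\<close>
  have ball: "y \<in> closure (S n)" if y: "y \<in> Z" "norm y < e" for y
  proof -
    have "x0 + y \<in> closure (S n)" "x0 - y \<in> closure (S n)"
      using y x0(1) by (auto intro!: x0(2) subspace_add[OF Z(1)] subspace_diff[OF Z(1)] simp: dist_norm)
    then have "x0 + y \<in> closure (S n)" "y - x0 \<in> closure (S n)" using neg[of "x0 - y"] by auto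
    then obtain f g where f: "\<And>k. f k \<in> S n" "f \<longlonglongrightarrow> x0 + y" and g: "\<And>k. g k \<in> S n" "g \<longlonglongrightarrow> y - x0"
      by (auto simp: closure_sequential)
    have "(1/2) *\<^sub>R (f k + g k) \<in> S n" for k
      using f(1)[of k] g(1)[of k] homog[of "f k + g k" "1/2"] tri[of "f k" "g k"]
        subspace_add[OF Z(1)] subspace_scale[OF Z(1)] by (auto simp: S_def)
    moreover have "(\<lambda>k. (1/2) *\<^sub>R (f k + g k)) \<longlonglongrightarrow> (1/2) *\<^sub>R ((x0 + y) + (y - x0))"
      by (intro tendsto_intros f g)
    moreover have "(1/2) *\<^sub>R ((x0 + y) + (y - x0)) = y"
      by (simp add: scaleR_2[symmetric])
    ultimately show ?thesis unfolding closure_sequential by (metis (no_types, lifting))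
  qed
  have step: "\<exists>z\<in>Z. p z \<le> n * c \<and> norm (y - z) < c * e / 2" if y: "y \<in> Z" "norm y < c * e" "c > 0" for y and c :: real
  proof -
    have "(1/c) *\<^sub>R y \<in> closure (S n)"
      using y subspace_scale[OF Z(1)] by (intro ball) (auto simp: field_simps)
    then obtain w where w: "w \<in> S n" "dist w ((1/c) *\<^sub>R y) < e/2"
      using e unfolding closure_approachable by (meson half_gt_zero)
    have "norm (y - c *\<^sub>R w) = c * norm ((1/c) *\<^sub>R y - w)"
      using \<open>c > 0\<close> norm_scaleR[of c "(1/c) *\<^sub>R y - w"] by (simp add: scaleR_diff_right)
    also have "\<dots> < c * (e / 2)" using w(2) \<open>c > 0\<close> by (simp add: dist_norm norm_minus_commute)
    finally have "norm (y - c *\<^sub>R w) < c * e / 2" by simp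
    moreover have "c * p w \<le> c * n" using w(1) \<open>c > 0\<close> by (simp add: S_def)
    moreover have "p (c *\<^sub>R w) \<le> c * p w" using w(1) \<open>c > 0\<close> homog[of w c] by (simp add: S_def)
    ultimately have "p (c *\<^sub>R w) \<le> c * n" "norm (y - c *\<^sub>R w) < c * e / 2" by linarith+
    then show ?thesis using w(1) subspace_scale[OF Z(1)]
      by (intro bexI[of _ "c *\<^sub>R w"]) (auto simp: S_def mult.commute)
  qed
  \<comment> \<open>As in the open mapping theorem: \<open>f k\<close> is the part of
    \<open>y\<close> not yet approximated. Each round halves the bound on its norm at a cost of at
    most \<open>n * (1/2)^k\<close>, so \<open>y\<close> is the sum of the pieces
    \<open>X k\<close>. Countable subadditivity then bounds \<open>p\<close> at \<open>y\<close>
    itself and not only at nearby points.\<close>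
  have bound: "p y \<le> 2 * n" if y: "y \<in> Z" "norm y < e" for y
  proof -
    define P where "P k r \<longleftrightarrow> r \<in> Z \<and> norm r < (1/2)^k * e \<and> (k = 0 \<longrightarrow> r = y)" for k :: nat and r
    have "\<exists>f. \<forall>k. P k (f k) \<and> p (f k - f (Suc k)) \<le> real n * (1/2)^k"
    proof (rule dependent_nat_choice)
      fix r k assume "P k r"
      then obtain z where z: "z \<in> Z" "p z \<le> n * (1/2)^k" "norm (r - z) < (1/2)^k * e / 2"
        using step[of r "(1/2)^k"] by (auto simp: P_def)
      then show "\<exists>s. P (Suc k) s \<and> p (r - s) \<le> real n * (1/2)^k"
        using \<open>P k r\<close> subspace_diff[OF Z(1)] by (intro exI[of _ "r - z"]) (auto simp: P_def)
    qed (use y in \<open>auto simp: P_def\<close>)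
    then obtain f where f: "\<And>k. P k (f k)" "\<And>k. p (f k - f (Suc k)) \<le> real n * (1/2)^k" by blast
    have f0: "f 0 = y" using f(1)[of 0] by (simp add: P_def)
    define X where "X k = f k - f (Suc k)" for k
    have XZ: "range X \<subseteq> Z" using f(1) subspace_diff[OF Z(1)] by (auto simp: X_def P_def)
    have geo: "summable (\<lambda>k. c * (1/2::real)^k)" for c by (intro summable_mult summable_geometric) simp
    have "norm (X k) \<le> 2 * e * (1/2)^k" for k
    proof -
      have "norm (f k) \<le> (1/2)^k * e" "norm (f (Suc k)) \<le> (1/2)^Suc k * e"
        using f(1)[of k] f(1)[of "Suc k"] by (auto simp: P_def)
      moreover have "(1/2)^Suc k * e \<le> (1/2)^k * e" using e by simp
      ultimately show ?thesis using norm_triangle_ineq4[of "f k" "f (Suc k)"]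
        unfolding X_def by (simp add: mult.commute mult.assoc)
    qed
    then have s1: "summable (\<lambda>k. norm (X k))" using geo[of "2 * e"] by (intro summable_comparison_test[OF _ geo]) auto
    have pX: "p (X k) \<le> n * (1/2)^k" "0 \<le> p (X k)" for k using f(2) XZ nonneg by (auto simp: X_def)
    then have s2: "summable (\<lambda>k. p (X k))" using geo[of n] by (intro summable_comparison_test[OF _ geo]) auto
    have "f \<longlonglongrightarrow> 0"
    proof (rule Lim_null_comparison)
      show "eventually (\<lambda>k. norm (f k) \<le> (1/2)^k * e) sequentially"
        using f(1) by (auto simp: P_def less_imp_le)
      show "(\<lambda>k. (1/2::real)^k * e) \<longlonglongrightarrow> 0"
        by (intro tendsto_mult_left_zero LIMSEQ_realpow_zero) auto
    qed
    then have "X sums (f 0 - 0)" unfolding X_def by (rule telescope_sums')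
    then have "suminf X = y" using f0 by (simp add: sums_iff)
    then have "p y \<le> (\<Sum>k. p (X k))" using subadd[OF XZ s1 s2] by simp
    also have "\<dots> \<le> (\<Sum>k. n * (1/2)^k)" by (intro suminf_le pX s2 geo)
    also have "\<dots> = 2 * n" by (subst suminf_mult) (auto simp: suminf_geometric)
    finally show ?thesis .
  qed
  have "p x \<le> (4 * n / e) * norm x" if x: "x \<in> Z" for x
  proof (cases "x = 0")
    case False
    define c where "c = e / (2 * norm x)"
    have c: "c > 0" "c * norm x < e" using False e by (auto simp: c_def)
    have "p x \<le> 1 / c * p (c *\<^sub>R x)"
      using homog[of "c *\<^sub>R x" "1 / c"] c subspace_scale[OF Z(1) x] by simp
    also have "\<dots> \<le> 1 / c * (2 * n)"
      using bound[of "c *\<^sub>R x"] c subspace_scale[OF Z(1) x] by (intro mult_left_mono) auto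
    finally show ?thesis using False e by (simp add: c_def field_simps)
  qed (use p0 in simp)
  then show thesis using e by (intro that[of "4 * n / e"]) auto
qed

section \<open>Bounded operators on a closed subspace\<close>

lemma bounded_operatorsD:
  assumes "T \<in> bounded_operators Z Y"
  shows "x \<in> Z \<Longrightarrow> y \<in> Z \<Longrightarrow> T (x + y) = T x + T y" "x \<in> Z \<Longrightarrow> T (c *\<^sub>R x) = c *\<^sub>R T x"
    "x \<in> Z \<Longrightarrow> T x \<in> Y" "x \<in> Z \<Longrightarrow> y \<in> Z \<Longrightarrow> T (x - y) = T x - T y" "T 0 = 0" "subspace Z"
proof -
  have T: "subspace Z" "\<And>x y. x \<in> Z \<Longrightarrow> y \<in> Z \<Longrightarrow> T (x + y) = T x + T y"
    "\<And>c x. x \<in> Z \<Longrightarrow> T (c *\<^sub>R x) = c *\<^sub>R T x"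
    using assms by (auto simp: bounded_operators_def linear_operator_on_def)
  then show "x \<in> Z \<Longrightarrow> y \<in> Z \<Longrightarrow> T (x - y) = T x - T y"
    using T(2)[of x "- y"] T(3)[of y "-1"] subspace_neg[OF T(1)] by simp
  show "T 0 = 0" using T(3)[of 0 0] subspace_0[OF T(1)] by simp
qed (use assms in \<open>auto simp: bounded_operators_def linear_operator_on_def\<close>)

lemma bounded_operators_sums:
  assumes T: "T \<in> bounded_operators Z Y" and "closed Z" and X: "\<And>n. X n \<in> Z" "X sums x"
  shows "x \<in> Z" "(\<lambda>n. T (X n)) sums T x"
proof -
  note T' = bounded_operatorsD[OF T]
  have S: "(\<Sum>i<n. X i) \<in> Z" for n by (intro subspace_sum[OF T'(6)] X(1))
  then show x: "x \<in> Z"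
    using closed_sequentially[OF \<open>closed Z\<close>, of "\<lambda>n. \<Sum>i<n. X i"] X(2) by (simp add: sums_def)
  obtain c where c: "\<And>x. x \<in> Z \<Longrightarrow> norm (T x) \<le> c * norm x"
    using T by (auto simp: bounded_operators_def opnorm_le_def)
  have TS: "(\<Sum>i<n. T (X i)) = T (\<Sum>i<n. X i)" for n
    by (induction n) (simp_all add: T' X S)
  have "(\<lambda>n. T (\<Sum>i<n. X i) - T x) \<longlonglongrightarrow> 0"
  proof (rule Lim_null_comparison)
    show "\<forall>\<^sub>F n in sequentially. norm (T (\<Sum>i<n. X i) - T x) \<le> c * norm ((\<Sum>i<n. X i) - x)"
      using c subspace_diff[OF T'(6) S x] T'(4)[OF S x] by (metis (no_types, lifting) always_eventually)
    have "(\<lambda>n. c * norm ((\<Sum>i<n. X i) - x)) \<longlonglongrightarrow> c * norm (x - x)"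
      using X(2) unfolding sums_def by (intro tendsto_intros)
    then show "(\<lambda>n. c * norm ((\<Sum>i<n. X i) - x)) \<longlonglongrightarrow> 0" by simp
  qed
  then show "(\<lambda>n. T (X n)) sums T x"
    unfolding sums_def TS by (simp add: LIM_zero_cancel)
qed

subsection \<open>The integrated equation in resolvent form\<close>

text \<open>The fundamental theorem of calculus for the product of \<open>a\<close> with the
  primitive of \<open>u\<close>. Only \<open>a\<close> is differentiated, as solutions are merely
  continuous.\<close>

lemma integral_scaleR_by_parts:
  fixes u :: "real \<Rightarrow> 'a::banach"
  assumes "s \<le> t" and u: "continuous_on {s..t} u" and a': "continuous_on {s..t} a'"
    and a: "\<And>r. r \<in> {s..t} \<Longrightarrow> (a has_real_derivative a' r) (at r within {s..t})"
  shows "integral {s..t} (\<lambda>r. a r *\<^sub>R u r) =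
    a t *\<^sub>R integral {s..t} u - integral {s..t} (\<lambda>r. a' r *\<^sub>R integral {s..r} u)"
proof -
  have a_cont: "continuous_on {s..t} a"
    using a DERIV_continuous continuous_on_eq_continuous_within by blast
  have W: "continuous_on {s..t} (\<lambda>r. integral {s..r} u)"
    using u by (intro indefinite_integral_continuous_1 integrable_continuous_interval)
  have "((\<lambda>r. a r *\<^sub>R u r + a' r *\<^sub>R integral {s..r} u) has_integral
      a t *\<^sub>R integral {s..t} u - a s *\<^sub>R integral {s..s} u) {s..t}"
    by (rule fundamental_theorem_of_calculus[OF \<open>s \<le> t\<close>])
      (auto intro!: has_vector_derivative_scaleR a integral_has_vector_derivative u)
  then have "integral {s..t} (\<lambda>r. a r *\<^sub>R u r + a' r *\<^sub>R integral {s..r} u) = a t *\<^sub>R integral {s..t} u"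
    by (simp add: integral_unique)
  also have "integral {s..t} (\<lambda>r. a r *\<^sub>R u r + a' r *\<^sub>R integral {s..r} u) =
      integral {s..t} (\<lambda>r. a r *\<^sub>R u r) + integral {s..t} (\<lambda>r. a' r *\<^sub>R integral {s..r} u)"
    by (intro integral_add integrable_continuous_interval continuous_intros a_cont u a' W)
  finally show ?thesis by (simp add: algebra_simps)
qed

locale integrated_equation =
  fixes R :: "'a::banach \<Rightarrow> 'a" and l :: real and X0 :: "'a set" and B :: "real \<Rightarrow> 'a \<Rightarrow> 'a"
    and \<beta> :: real
  assumes R: "bounded_linear R" and X0: "subspace X0" "closed X0"
    and B_add: "\<And>t x y. x \<in> X0 \<Longrightarrow> y \<in> X0 \<Longrightarrow> B t (x + y) = B t x + B t y"
    and B_scaleR: "\<And>t c x. x \<in> X0 \<Longrightarrow> B t (c *\<^sub>R x) = c *\<^sub>R B t x"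
    and B_cont: "\<And>x. x \<in> X0 \<Longrightarrow> continuous_on UNIV (\<lambda>t. B t x)"
    and B_bound: "\<And>t x. x \<in> X0 \<Longrightarrow> norm (B t x) \<le> \<beta> * norm x"
    and \<beta>: "0 \<le> \<beta>"
begin

interpretation R: bounded_linear R by (fact R)

lemmas X0_closed_ops = subspace_0[OF X0(1)] subspace_add[OF X0(1)] subspace_diff[OF X0(1)]
  subspace_scale[OF X0(1)] subspace_neg[OF X0(1)] subspace_sum[OF X0(1)]

lemma B_diff: "x \<in> X0 \<Longrightarrow> y \<in> X0 \<Longrightarrow> B t (x - y) = B t x - B t y"
  using B_add[of x "- y" t] B_scaleR[of y t "-1"] X0_closed_ops by simp

lemma B_0 [simp]: "B t 0 = 0"
  using B_scaleR[of 0 t 0] X0_closed_ops by simp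

text \<open>The increment splits into \<open>B r (u r - u s)\<close>, small by the uniform bound
  \<open>\<beta>\<close>, and \<open>B r (u s) - B s (u s)\<close>, small by strong continuity at
  the fixed vector \<open>u s\<close>.\<close>

lemma continuous_on_B:
  assumes u: "continuous_on S u" "u ` S \<subseteq> X0"
  shows "continuous_on S (\<lambda>r. B r (u r))"
  unfolding continuous_on_def
proof
  fix s assume s: "s \<in> S"
  have "((\<lambda>r. B r (u r) - B s (u s)) \<longlongrightarrow> 0) (at s within S)"
  proof (rule Lim_null_comparison)
    show "\<forall>\<^sub>F r in at s within S. norm (B r (u r) - B s (u s)) \<le>
        \<beta> * norm (u r - u s) + norm (B r (u s) - B s (u s))"
      unfolding eventually_at_topological
    proof (intro exI[of _ UNIV] conjI ballI impI)
      fix r assume "r \<in> S"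
      then have *: "u r \<in> X0" "u s \<in> X0" using s u by auto
      have "B r (u r) - B s (u s) = B r (u r - u s) + (B r (u s) - B s (u s))"
        using * by (simp add: B_diff)
      then have "norm (B r (u r) - B s (u s)) \<le> norm (B r (u r - u s)) + norm (B r (u s) - B s (u s))"
        by (metis norm_triangle_ineq)
      then show "norm (B r (u r) - B s (u s)) \<le>
        \<beta> * norm (u r - u s) + norm (B r (u s) - B s (u s))"
        using B_bound[of "u r - u s" r] * X0_closed_ops(3) by fastforce
    qed auto
    have "((\<lambda>r. B r (u s)) \<longlongrightarrow> B s (u s)) (at s within S)"
      using B_cont[of "u s"] s u continuous_on_subset[OF _ subset_UNIV] unfolding continuous_on_def by blast
    moreover have "(u \<longlongrightarrow> u s) (at s within S)" using u s by (auto simp: continuous_on_def)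
    ultimately have "((\<lambda>r. \<beta> * norm (u r - u s) + norm (B r (u s) - B s (u s))) \<longlongrightarrow>
      \<beta> * norm (u s - u s) + norm (B s (u s) - B s (u s))) (at s within S)"
      by (intro tendsto_intros)
    then show "((\<lambda>r. \<beta> * norm (u r - u s) + norm (B r (u s) - B s (u s))) \<longlongrightarrow> 0) (at s within S)"
      by simp
  qed
  then show "((\<lambda>r. B r (u r)) \<longlongrightarrow> B s (u s)) (at s within S)"
    by (simp add: LIM_zero_cancel)
qed

text \<open>
  With \<open>R = (l I - A)\<^sup>-\<^sup>1\<close>, this says that \<open>W = \<integral>\<^sub>s\<^sup>t u\<close> lies in the domain of \<open>A\<close> and that
  \<open>u t = u s + A W + \<integral>\<^sub>s\<^sup>t g\<close>; all operators occurring are now bounded and everywhere defined.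
\<close>

definition mild :: "real \<Rightarrow> real \<Rightarrow> (real \<Rightarrow> 'a) \<Rightarrow> (real \<Rightarrow> 'a) \<Rightarrow> bool" where
  "mild s t u g \<longleftrightarrow>
     integral {s..t} u = R (l *\<^sub>R integral {s..t} u - u t + u s + integral {s..t} g)"

section \<open>Calculus of the resolvent equation\<close>

lemma mild_add:
  assumes "continuous_on {s..t} u" "continuous_on {s..t} v" "continuous_on {s..t} f" "continuous_on {s..t} g"
    and "mild s t u f" "mild s t v g"
  shows "mild s t (\<lambda>r. u r + v r) (\<lambda>r. f r + g r)"
proof -
  have 1: "integral {s..t} (\<lambda>r. u r + v r) = integral {s..t} u + integral {s..t} v"
    "integral {s..t} (\<lambda>r. f r + g r) = integral {s..t} f + integral {s..t} g"
    by (intro integral_add integrable_continuous_interval assms)+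
  have "l *\<^sub>R (integral {s..t} u + integral {s..t} v) - (u t + v t) + (u s + v s) + (integral {s..t} f + integral {s..t} g)
    = (l *\<^sub>R integral {s..t} u - u t + u s + integral {s..t} f) + (l *\<^sub>R integral {s..t} v - v t + v s + integral {s..t} g)"
    by (simp add: algebra_simps)
  then show ?thesis
    using arg_cong2[OF assms(5)[unfolded mild_def] assms(6)[unfolded mild_def], of "(+)"]
    unfolding mild_def 1 by (simp only: R.add[symmetric])
qed

lemma mild_scaleR:
  assumes "mild s t u f"
  shows "mild s t (\<lambda>r. c *\<^sub>R u r) (\<lambda>r. c *\<^sub>R f r)"
proof -
  have "l *\<^sub>R c *\<^sub>R integral {s..t} u - c *\<^sub>R u t + c *\<^sub>R u s + c *\<^sub>R integral {s..t} f =
    c *\<^sub>R (l *\<^sub>R integral {s..t} u - u t + u s + integral {s..t} f)"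
    by (simp add: algebra_simps)
  then show ?thesis using assms unfolding mild_def integral_cmul by (simp only: R.scaleR)
qed

lemma mild_cong:
  assumes "mild s t u f" "s \<le> t" "\<And>r. r \<in> {s..t} \<Longrightarrow> u r = v r" "\<And>r. r \<in> {s..t} \<Longrightarrow> f r = g r"
  shows "mild s t v g"
proof -
  have "integral {s..t} u = integral {s..t} v" "integral {s..t} f = integral {s..t} g"
    using assms by (auto intro!: integral_cong)
  then show ?thesis using assms by (simp add: mild_def)
qed

text \<open>Both integrals are additive over adjacent intervals and the two occurrences of
  \<open>u r\<close> cancel, so the equations may be added inside \<open>R\<close>;
  \<open>mild_tail\<close> subtracts them instead.\<close>

lemma mild_trans:
  assumes "s \<le> r" "r \<le> t" "continuous_on {s..t} u" "continuous_on {s..t} f" "mild s r u f" "mild r t u f"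
  shows "mild s t u f"
proof -
  have 1: "integral {s..t} u = integral {s..r} u + integral {r..t} u"
    "integral {s..t} f = integral {s..r} f + integral {r..t} f"
    using assms by (auto intro!: Henstock_Kurzweil_Integration.integral_combine[symmetric] integrable_continuous_interval)
  have "l *\<^sub>R (integral {s..r} u + integral {r..t} u) - u t + u s + (integral {s..r} f + integral {r..t} f) =
    (l *\<^sub>R integral {s..r} u - u r + u s + integral {s..r} f) + (l *\<^sub>R integral {r..t} u - u t + u r + integral {r..t} f)"
    by (simp add: algebra_simps)
  then show ?thesis
    using arg_cong2[OF assms(5)[unfolded mild_def] assms(6)[unfolded mild_def], of "(+)"]
    unfolding mild_def 1 by (simp only: R.add[symmetric])
qed

lemma mild_tail:
  assumes "s \<le> r" "r \<le> t" "continuous_on {s..t} u" "continuous_on {s..t} f" "mild s r u f" "mild s t u f"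
  shows "mild r t u f"
proof -
  have 1: "integral {r..t} u = integral {s..t} u - integral {s..r} u"
    "integral {r..t} f = integral {s..t} f - integral {s..r} f"
    using assms Henstock_Kurzweil_Integration.integral_combine[of s r t u]
      Henstock_Kurzweil_Integration.integral_combine[of s r t f]
    by (auto simp: algebra_simps integrable_continuous_interval)
  have "l *\<^sub>R (integral {s..t} u - integral {s..r} u) - u t + u r + (integral {s..t} f - integral {s..r} f) =
    (l *\<^sub>R integral {s..t} u - u t + u s + integral {s..t} f) - (l *\<^sub>R integral {s..r} u - u r + u s + integral {s..r} f)"
    by (simp add: algebra_simps)
  then show ?thesis
    using arg_cong2[OF assms(6)[unfolded mild_def] assms(5)[unfolded mild_def], of "(-)"]
    unfolding mild_def 1 by (simp only: R.diff[symmetric])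
qed

lemma mild_shift:
  assumes "mild s t u f"
  shows "mild (s + c) (t + c) (\<lambda>r. u (r - c)) (\<lambda>r. f (r - c))"
proof -
  have 1: "integral {s + c..t + c} (\<lambda>r. g (r - c)) = integral {s..t} g" for g :: "real \<Rightarrow> 'a"
    using integral_shift_Icc_real[of s t "\<lambda>r. g (r - c)" c, symmetric] by (simp add: o_def)
  show ?thesis using assms by (simp add: mild_def 1)
qed

text \<open>Here the resolvent form pays off: every term passes to the limit because
  \<open>R\<close> is continuous, which replaces the closedness of \<open>A\<close>.\<close>

lemma mild_limit:
  assumes "s \<le> t" "\<And>n. continuous_on {s..t} (u n)" "\<And>n. continuous_on {s..t} (f n)"
    and lim: "uniform_limit {s..t} u v sequentially" "uniform_limit {s..t} f g sequentially"
    and "\<And>n. mild s t (u n) (f n)"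
  shows "mild s t v g"
proof -
  have int: "(\<lambda>n. integral {s..t} (w n)) \<longlonglongrightarrow> integral {s..t} w'"
    if "\<And>n. continuous_on {s..t} (w n)" "uniform_limit {s..t} w w' sequentially" for w and w' :: "real \<Rightarrow> 'a"
    using uniform_limit_integral[OF that(2,1)] by (metis integral_unique LIMSEQ_unique trivial_limit_sequentially ext)
  have pt: "(\<lambda>n. u n r) \<longlonglongrightarrow> v r" if "r \<in> {s..t}" for r
    using tendsto_uniform_limitI[OF lim(1) that] .
  have "(\<lambda>n. R (l *\<^sub>R integral {s..t} (u n) - u n t + u n s + integral {s..t} (f n))) \<longlonglongrightarrow>
      R (l *\<^sub>R integral {s..t} v - v t + v s + integral {s..t} g)"
    using \<open>s \<le> t\<close> by (intro R.tendsto tendsto_intros int pt assms) auto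
  moreover have "(\<lambda>n. integral {s..t} (u n)) \<longlonglongrightarrow> integral {s..t} v"
    by (intro int assms)
  ultimately show ?thesis
    using assms(6) unfolding mild_def by (metis (no_types, lifting) LIMSEQ_unique ext)
qed

text \<open>A product rule that never differentiates \<open>u\<close>. Integration by parts leaves
  \<open>a t\<close> times the primitive \<open>W t\<close> minus the integral of
  \<open>a' W\<close>. Since \<open>W r = R (P r)\<close> for every \<open>r\<close>, the operator
  \<open>R\<close> can be pulled out of that integral, and the remaining argument is the one for the
  product, with \<open>a' u\<close> as additional forcing term.\<close>

lemma mild_mult:
  assumes "s \<le> t" and u: "continuous_on {s..t} u" and g: "continuous_on {s..t} g"
    and a': "continuous_on {s..t} a'"
    and a: "\<And>r. r \<in> {s..t} \<Longrightarrow> (a has_real_derivative a' r) (at r within {s..t})"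
    and m: "\<And>r. r \<in> {s..t} \<Longrightarrow> mild s r u g"
  shows "mild s t (\<lambda>r. a r *\<^sub>R u r) (\<lambda>r. a r *\<^sub>R g r + a' r *\<^sub>R u r)"
proof -
  define W G where "W r = integral {s..r} u" and "G r = integral {s..r} g" for r
  define P where "P r = l *\<^sub>R W r - u r + u s + G r" for r
  have a_cont: "continuous_on {s..t} a"
    using a DERIV_continuous continuous_on_eq_continuous_within by blast
  have WG: "continuous_on {s..t} W" "continuous_on {s..t} G"
    unfolding W_def G_def using u g by (auto intro!: indefinite_integral_continuous_1 integrable_continuous_interval)
  have P: "continuous_on {s..t} P" unfolding P_def by (intro continuous_intros WG u)
  have WP: "W r = R (P r)" if "r \<in> {s..t}" for r
    using m[OF that] by (simp add: mild_def W_def G_def P_def)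
  note I = integrable_continuous_interval
  have 1: "integral {s..t} (\<lambda>r. a r *\<^sub>R u r) = a t *\<^sub>R W t - integral {s..t} (\<lambda>r. a' r *\<^sub>R W r)"
    "integral {s..t} (\<lambda>r. a r *\<^sub>R g r) = a t *\<^sub>R G t - integral {s..t} (\<lambda>r. a' r *\<^sub>R G r)"
    unfolding W_def G_def by (intro integral_scaleR_by_parts assms; assumption)+
  have 2: "integral {s..t} (\<lambda>r. a' r *\<^sub>R W r) = R (integral {s..t} (\<lambda>r. a' r *\<^sub>R P r))"
  proof -
    have "integral {s..t} (\<lambda>r. a' r *\<^sub>R W r) = integral {s..t} (R \<circ> (\<lambda>r. a' r *\<^sub>R P r))"
      by (intro integral_cong) (simp add: WP R.scaleR)
    then show ?thesis by (subst (asm) integral_linear[OF _ R]) (auto intro!: I continuous_intros a' P)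
  qed
  have a'I: "integral {s..t} a' = a t - a s"
    by (rule integral_unique, rule fundamental_theorem_of_calculus[OF \<open>s \<le> t\<close>])
      (use a in \<open>simp add: has_real_derivative_iff_has_vector_derivative\<close>)
  have 3: "integral {s..t} (\<lambda>r. a' r *\<^sub>R P r) = l *\<^sub>R integral {s..t} (\<lambda>r. a' r *\<^sub>R W r)
      - integral {s..t} (\<lambda>r. a' r *\<^sub>R u r) + (a t - a s) *\<^sub>R u s + integral {s..t} (\<lambda>r. a' r *\<^sub>R G r)"
  proof -
    have "integral {s..t} (\<lambda>r. a' r *\<^sub>R P r) = integral {s..t} (\<lambda>r. l *\<^sub>R a' r *\<^sub>R W r - a' r *\<^sub>R u r + a' r *\<^sub>R u s + a' r *\<^sub>R G r)"
      by (intro integral_cong) (simp add: P_def algebra_simps)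
    also have "\<dots> = integral {s..t} (\<lambda>r. l *\<^sub>R a' r *\<^sub>R W r) - integral {s..t} (\<lambda>r. a' r *\<^sub>R u r)
       + integral {s..t} (\<lambda>r. a' r *\<^sub>R u s) + integral {s..t} (\<lambda>r. a' r *\<^sub>R G r)"
      by (intro integral_unique has_integral_add has_integral_diff integrable_integral I continuous_intros WG u a')
    also have "integral {s..t} (\<lambda>r. a' r *\<^sub>R u s) = (a t - a s) *\<^sub>R u s"
      using integral_linear[OF I[OF a'] bounded_linear_scaleR_left[of "u s"]] a'I by (simp add: o_def)
    finally show ?thesis unfolding integral_cmul .
  qed
  have 4: "integral {s..t} (\<lambda>r. a r *\<^sub>R g r + a' r *\<^sub>R u r) =
      integral {s..t} (\<lambda>r. a r *\<^sub>R g r) + integral {s..t} (\<lambda>r. a' r *\<^sub>R u r)"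
    by (intro integral_add I continuous_intros a_cont g a' u)
  have "integral {s..t} (\<lambda>r. a r *\<^sub>R u r) = R (a t *\<^sub>R P t - integral {s..t} (\<lambda>r. a' r *\<^sub>R P r))"
    unfolding 1(1) 2 using \<open>s \<le> t\<close> by (simp add: WP R.diff R.scaleR)
  also have "a t *\<^sub>R P t - integral {s..t} (\<lambda>r. a' r *\<^sub>R P r) =
      l *\<^sub>R integral {s..t} (\<lambda>r. a r *\<^sub>R u r) - a t *\<^sub>R u t + a s *\<^sub>R u s
      + integral {s..t} (\<lambda>r. a r *\<^sub>R g r + a' r *\<^sub>R u r)"
    unfolding 4 3 1 P_def[of t] by (simp add: algebra_simps)
  finally show ?thesis unfolding mild_def .
qed

text \<open>Requiring the equation for all pairs of times makes restriction immediate and covers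
  intervals without a least element, such as \<open>{..t}\<close> and the whole line, where there is
  no initial time.\<close>

definition sol :: "real set \<Rightarrow> (real \<Rightarrow> 'a) \<Rightarrow> (real \<Rightarrow> 'a) \<Rightarrow> bool" where
  "sol S f u \<longleftrightarrow> is_interval S \<and> continuous_on S f \<and> continuous_on S u \<and> u ` S \<subseteq> X0 \<and>
     (\<forall>s\<in>S. \<forall>t\<in>S. s \<le> t \<longrightarrow> mild s t u (\<lambda>r. B r (u r) + f r))"

lemma solD:
  assumes "sol S f u"
  shows "is_interval S" "continuous_on S f" "continuous_on S u" "\<And>t. t \<in> S \<Longrightarrow> u t \<in> X0"
    "\<And>s t. s \<in> S \<Longrightarrow> t \<in> S \<Longrightarrow> s \<le> t \<Longrightarrow> mild s t u (\<lambda>r. B r (u r) + f r)"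
    "continuous_on S (\<lambda>r. B r (u r) + f r)"
proof -
  show "continuous_on S (\<lambda>r. B r (u r) + f r)"
    using assms continuous_on_B by (intro continuous_on_add) (simp_all add: sol_def)
qed (use assms in \<open>auto simp: sol_def\<close>)

lemma interval_subset: "is_interval S \<Longrightarrow> s \<in> S \<Longrightarrow> t \<in> S \<Longrightarrow> {s..t::real} \<subseteq> S"
  by (meson atLeastAtMost_iff mem_is_interval_1_I subsetI)

lemma sol_subset: "sol S f u \<Longrightarrow> is_interval T \<Longrightarrow> T \<subseteq> S \<Longrightarrow> sol T f u"
  unfolding sol_def by (meson continuous_on_subset image_mono order_trans subsetD)

lemma sol_cong:
  assumes "sol S f u" "\<And>r. r \<in> S \<Longrightarrow> f r = g r" "\<And>r. r \<in> S \<Longrightarrow> u r = v r"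
  shows "sol S g v"
  unfolding sol_def
proof (intro conjI ballI impI)
  show "continuous_on S g" "continuous_on S v"
    by (rule continuous_on_eq[OF solD(2)[OF assms(1)] assms(2)], assumption)
      (rule continuous_on_eq[OF solD(3)[OF assms(1)] assms(3)], assumption)
  show "v ` S \<subseteq> X0" using solD(4)[OF assms(1)] assms(3) by auto
  fix s t assume st: "s \<in> S" "t \<in> S" "s \<le> t"
  then have "{s..t} \<subseteq> S" using interval_subset solD(1)[OF assms(1)] by blast
  then show "mild s t v (\<lambda>r. B r (v r) + g r)"
    using assms(2,3) by (intro mild_cong[OF solD(5)[OF assms(1) st] st(3)]) auto
qed (rule solD[OF assms(1)])

lemma sol_add:
  assumes "sol S f u" "sol S g v"
  shows "sol S (\<lambda>r. f r + g r) (\<lambda>r. u r + v r)"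
  unfolding sol_def
proof (intro conjI ballI impI)
  show "continuous_on S (\<lambda>r. f r + g r)" "continuous_on S (\<lambda>r. u r + v r)"
    by (intro continuous_intros solD[OF assms(1)] solD[OF assms(2)])+
  show "(\<lambda>r. u r + v r) ` S \<subseteq> X0"
    using solD(4)[OF assms(1)] solD(4)[OF assms(2)] X0_closed_ops by auto
  fix s t assume st: "s \<in> S" "t \<in> S" "s \<le> t"
  then have sub: "{s..t} \<subseteq> S" using interval_subset solD(1)[OF assms(1)] by blast
  have "mild s t (\<lambda>r. u r + v r) (\<lambda>r. (B r (u r) + f r) + (B r (v r) + g r))"
    by (intro mild_add continuous_on_subset[OF _ sub] solD[OF assms(1)] solD[OF assms(2)] st)
  then show "mild s t (\<lambda>r. u r + v r) (\<lambda>r. B r (u r + v r) + (f r + g r))"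
  proof (rule mild_cong[OF _ st(3)])
    show "(B r (u r) + f r) + (B r (v r) + g r) = B r (u r + v r) + (f r + g r)" if "r \<in> {s..t}" for r
    using that sub B_add[of "u r" "v r" r] solD(4)[OF assms(1)] solD(4)[OF assms(2)] by (auto simp: algebra_simps)
  qed simp
qed (rule solD[OF assms(1)])

lemma sol_scaleR:
  assumes "sol S f u"
  shows "sol S (\<lambda>r. c *\<^sub>R f r) (\<lambda>r. c *\<^sub>R u r)"
  unfolding sol_def
proof (intro conjI ballI impI)
  show "continuous_on S (\<lambda>r. c *\<^sub>R f r)" "continuous_on S (\<lambda>r. c *\<^sub>R u r)"
    by (intro continuous_intros solD[OF assms])+
  show "(\<lambda>r. c *\<^sub>R u r) ` S \<subseteq> X0" using solD(4)[OF assms] X0_closed_ops by auto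
  fix s t assume st: "s \<in> S" "t \<in> S" "s \<le> t"
  then have sub: "{s..t} \<subseteq> S" using interval_subset solD(1)[OF assms(1)] by blast
  have "c *\<^sub>R (B r (u r) + f r) = B r (c *\<^sub>R u r) + c *\<^sub>R f r" if "r \<in> {s..t}" for r
    using that sub B_scaleR[of "u r"] solD(4)[OF assms(1)] by (auto simp: algebra_simps)
  then show "mild s t (\<lambda>r. c *\<^sub>R u r) (\<lambda>r. B r (c *\<^sub>R u r) + c *\<^sub>R f r)"
    by (intro mild_cong[OF mild_scaleR[OF solD(5)[OF assms st], of c] st(3)]) auto
qed (rule solD[OF assms(1)])

lemma sol_diff: "sol S f u \<Longrightarrow> sol S g v \<Longrightarrow> sol S (\<lambda>r. f r - g r) (\<lambda>r. u r - v r)"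
  using sol_add[of S f u "\<lambda>r. (-1) *\<^sub>R g r" "\<lambda>r. (-1) *\<^sub>R v r"] sol_scaleR[of S g v "-1"] by simp

lemma sol_zero: "is_interval S \<Longrightarrow> sol S (\<lambda>_. 0) (\<lambda>_. 0)"
  using X0_closed_ops by (auto simp: sol_def mild_def R.zero)

text \<open>Initial value problems give the equation from \<open>a\<close> only; subtracting it on
  \<open>{a..s}\<close> from that on \<open>{a..t}\<close> yields the pair \<open>s\<close>,
  \<open>t\<close>.\<close>

lemma sol_startI:
  assumes S: "is_interval S" "a \<in> S" "S \<subseteq> {a..}"
    and c: "continuous_on S f" "continuous_on S u" "u ` S \<subseteq> X0"
    and m: "\<And>t. t \<in> S \<Longrightarrow> mild a t u (\<lambda>r. B r (u r) + f r)"
  shows "sol S f u"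
  unfolding sol_def
proof (intro conjI ballI impI)
  fix s t assume st: "s \<in> S" "t \<in> S" "s \<le> t"
  then have *: "a \<le> s" "{a..t} \<subseteq> S" using S(3) interval_subset[OF S(1,2)] by auto
  have "continuous_on S (\<lambda>r. B r (u r) + f r)"
    by (intro continuous_on_add continuous_on_B c)
  then show "mild s t u (\<lambda>r. B r (u r) + f r)"
    using continuous_on_subset[OF _ *(2)] c m st by (intro mild_tail[OF *(1) st(3)]) simp_all
qed (fact S c)+

text \<open>Closedness of the pieces, which meet only in \<open>b\<close>, makes the pasted
  functions continuous; a pair of times on different sides of \<open>b\<close> is treated by
  concatenation.\<close>

lemma sol_glue:
  assumes P: "sol P f u" and Q: "sol Q f u" and S: "P \<union> Q = S" "is_interval S"
    and b: "b \<in> P" "b \<in> Q" "P \<subseteq> {..b}" "Q \<subseteq> {b..}" and closed: "closed P" "closed Q"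
  shows "sol S f u"
  unfolding sol_def
proof (intro conjI ballI impI)
  show c: "continuous_on S f" "continuous_on S u" and X: "u ` S \<subseteq> X0"
    using continuous_on_closed_Un[OF closed solD(2)[OF P] solD(2)[OF Q]]
      continuous_on_closed_Un[OF closed solD(3)[OF P] solD(3)[OF Q]]
      solD(4)[OF P] solD(4)[OF Q] S(1) by auto
  fix s t assume st: "s \<in> S" "t \<in> S" "s \<le> t"
  then have sub: "{s..t} \<subseteq> S" using interval_subset S(2) by blast
  have "continuous_on S (\<lambda>r. B r (u r) + f r)"
    by (intro continuous_on_add continuous_on_B c X)
  then have c': "continuous_on {s..t} u" "continuous_on {s..t} (\<lambda>r. B r (u r) + f r)"
    using continuous_on_subset[OF _ sub] c by simp_all
  consider "t \<in> P" "s \<in> P" | "s \<in> Q" "t \<in> Q" | "s \<in> P" "t \<in> Q" | "s \<in> Q" "t \<in> P"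
    using st S(1) by blast
  then show "mild s t u (\<lambda>r. B r (u r) + f r)"
  proof cases
    case 1
    then show ?thesis using solD(5)[OF P] st(3) by simp
  next
    case 2
    then show ?thesis using solD(5)[OF Q] st(3) by simp
  next
    case 3
    then have "s \<le> b" "b \<le> t" using b by auto
    then show ?thesis
      using mild_trans[OF _ _ c'] solD(5)[OF P 3(1) b(1)] solD(5)[OF Q b(2) 3(2)] by simp
  next
    case 4
    then have "b \<le> s" "t \<le> b" using b by auto
    then have "s = b" "t = b" using st by simp_all
    then show ?thesis using solD(5)[OF P b(1) b(1)] by simp
  qed
qed (rule S)

text \<open>One constant \<open>\<beta>\<close> bounds all \<open>B r\<close>, so uniform
  convergence of \<open>u n\<close> carries over to \<open>B r (u n r)\<close>. This serves both the
  Neumann series and the closed graph argument.\<close>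

lemma sol_limit:
  assumes S: "is_interval S" and sol: "\<And>n. sol S (f n) (u n)"
    and lim: "uniform_limit S u v sequentially" "uniform_limit S f g sequentially"
  shows "sol S g v"
  unfolding sol_def
proof (intro conjI ballI impI)
  show c: "continuous_on S g" "continuous_on S v"
    by (rule uniform_limit_theorem[OF _ lim(2)], simp_all add: solD(2)[OF sol])
      (rule uniform_limit_theorem[OF _ lim(1)], simp_all add: solD(3)[OF sol])
  show vX: "v ` S \<subseteq> X0"
  proof safe
    fix r assume "r \<in> S"
    then show "v r \<in> X0"
      by (intro closed_sequentially[OF X0(2) _ tendsto_uniform_limitI[OF lim(1)]] solD(4)[OF sol])
  qed
  fix s t assume st: "s \<in> S" "t \<in> S" "s \<le> t"
  then have sub: "{s..t} \<subseteq> S" using interval_subset S by blast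
  have "uniform_limit S (\<lambda>n r. B r (u n r)) (\<lambda>r. B r (v r)) sequentially"
  proof (rule uniform_limitI)
    fix e :: real assume "e > 0"
    then have "\<forall>\<^sub>F n in sequentially. \<forall>r\<in>S. dist (u n r) (v r) < e / (\<beta> + 1)"
      using \<beta> by (intro uniform_limitD[OF lim(1)]) simp
    then show "\<forall>\<^sub>F n in sequentially. \<forall>r\<in>S. dist (B r (u n r)) (B r (v r)) < e"
    proof (rule eventually_mono, safe)
      fix n r assume *: "\<forall>r\<in>S. dist (u n r) (v r) < e / (\<beta> + 1)" "r \<in> S"
      then have "dist (B r (u n r)) (B r (v r)) \<le> \<beta> * dist (u n r) (v r)"
        using B_diff[of "u n r" "v r" r] B_bound[of "u n r - v r" r] vX solD(4)[OF sol, of r n]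
          X0_closed_ops(3)[of "u n r" "v r"] by (simp add: dist_norm image_subset_iff)
      also have "\<dots> \<le> \<beta> * (e / (\<beta> + 1))" using * \<beta> by (intro mult_left_mono) auto
      also have "\<dots> < e" using \<open>e > 0\<close> \<beta> by (simp add: field_simps)
      finally show "dist (B r (u n r)) (B r (v r)) < e" .
    qed
  qed
  then have Bf: "uniform_limit S (\<lambda>n r. B r (u n r) + f n r) (\<lambda>r. B r (v r) + g r) sequentially"
    by (rule uniform_limit_add) (rule lim)
  show "mild s t v (\<lambda>r. B r (v r) + g r)"
    by (rule mild_limit[OF st(3) _ _ uniform_limit_on_subset[OF lim(1) sub] uniform_limit_on_subset[OF Bf sub]])
      (rule continuous_on_subset[OF solD(3)[OF sol] sub] continuous_on_subset[OF solD(6)[OF sol] sub]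
        solD(5)[OF sol st])+
qed (rule S)

text \<open>Used with two kinds of scalar factor: the primitive of the bump, which switches an orbit
  on, and the exponential weight, which produces decay.\<close>

lemma sol_mult:
  assumes u: "sol S f u" and a': "continuous_on S a'"
    and a: "\<And>r. r \<in> S \<Longrightarrow> (a has_real_derivative a' r) (at r within S)"
  shows "sol S (\<lambda>r. a r *\<^sub>R f r + a' r *\<^sub>R u r) (\<lambda>r. a r *\<^sub>R u r)"
  unfolding sol_def
proof (intro conjI ballI impI)
  have a_cont: "continuous_on S a"
    using a DERIV_continuous continuous_on_eq_continuous_within by blast
  show "continuous_on S (\<lambda>r. a r *\<^sub>R f r + a' r *\<^sub>R u r)" "continuous_on S (\<lambda>r. a r *\<^sub>R u r)"
    by (intro continuous_intros solD[OF u] a_cont a')+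
  show "(\<lambda>r. a r *\<^sub>R u r) ` S \<subseteq> X0" using solD(4)[OF u] X0_closed_ops by auto
  fix s t assume st: "s \<in> S" "t \<in> S" "s \<le> t"
  then have sub: "{s..t} \<subseteq> S" using interval_subset solD(1)[OF u] by blast
  have "mild s t (\<lambda>r. a r *\<^sub>R u r) (\<lambda>r. a r *\<^sub>R (B r (u r) + f r) + a' r *\<^sub>R u r)"
  proof (rule mild_mult[OF st(3)])
    show "(a has_real_derivative a' r) (at r within {s..t})" "mild s r u (\<lambda>r. B r (u r) + f r)"
      if "r \<in> {s..t}" for r
      using that sub st a[of r] DERIV_subset[OF _ sub] solD(5)[OF u, of s r] by auto
  qed (use continuous_on_subset[OF _ sub] solD[OF u] a' in auto)
  then show "mild s t (\<lambda>r. a r *\<^sub>R u r) (\<lambda>r. B r (a r *\<^sub>R u r) + (a r *\<^sub>R f r + a' r *\<^sub>R u r))"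
  proof (rule mild_cong[OF _ st(3)])
    show "a r *\<^sub>R (B r (u r) + f r) + a' r *\<^sub>R u r = B r (a r *\<^sub>R u r) + (a r *\<^sub>R f r + a' r *\<^sub>R u r)"
    if "r \<in> {s..t}" for r
    using that sub solD(4)[OF u] B_scaleR[of "u r" r "a r"] by (auto simp: algebra_simps)
  qed simp
qed (rule solD[OF u])

end

subsection \<open>Forced solutions and local bounds\<close>

text \<open>In the application \<open>q\<close> is \<open>\<delta> h\<close>. The condition
  \<open>q * \<beta> \<le> 1 / 2\<close> makes the unperturbed response followed by \<open>B\<close>
  a contraction by one half, whatever the initial time. The unperturbed equation is autonomous,
  hence \<open>forcing\<close> on \<open>{0..h}\<close> can be translated to any interval of this
  length.\<close>

locale perturbed_family = integrated_equation R l X0 B \<beta>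
  for R :: "'a::banach \<Rightarrow> 'a" and l X0 B \<beta> +
  fixes h q :: real and U :: "real \<Rightarrow> real \<Rightarrow> 'a \<Rightarrow> 'a"
  assumes h: "0 < h" and q: "0 \<le> q" "q * \<beta> \<le> 1 / 2"
    and forcing: "\<And>g M. continuous_on {0..h} g \<Longrightarrow> (\<And>s. s \<in> {0..h} \<Longrightarrow> norm (g s) \<le> M) \<Longrightarrow>
      \<exists>u. continuous_on {0..h} u \<and> u ` {0..h} \<subseteq> X0 \<and> u 0 = 0 \<and>
        (\<forall>t\<in>{0..h}. mild 0 t u g \<and> norm (u t) \<le> q * M)"
    and U_family: "evolution_family X0 U"
    and U_sol: "\<And>t0 x. x \<in> X0 \<Longrightarrow> sol {t0..} (\<lambda>_. 0) (\<lambda>t. U t t0 x)"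
    and U_unique: "\<And>t0 x v t. x \<in> X0 \<Longrightarrow> sol {t0..} (\<lambda>_. 0) v \<Longrightarrow> v t0 = x \<Longrightarrow> t0 \<le> t \<Longrightarrow> v t = U t t0 x"
begin

lemma U_bounded_operators: "s \<le> t \<Longrightarrow> U t s \<in> bounded_operators X0 X0"
  using U_family by (simp add: evolution_family_def)

lemmas U_mem = bounded_operatorsD(3)[OF U_bounded_operators]
lemmas U_add = bounded_operatorsD(1)[OF U_bounded_operators]
lemmas U_diff = bounded_operatorsD(4)[OF U_bounded_operators]
lemmas U_scaleR = bounded_operatorsD(2)[OF U_bounded_operators]
lemmas U_0 = bounded_operatorsD(5)[OF U_bounded_operators]

lemma U_refl: "x \<in> X0 \<Longrightarrow> U t t x = x"
  using U_family by (simp add: evolution_family_def)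

lemma U_trans: "s \<le> r \<Longrightarrow> r \<le> t \<Longrightarrow> x \<in> X0 \<Longrightarrow> U t r (U r s x) = U t s x"
  using U_family by (simp add: evolution_family_def)

lemma U_cont: "x \<in> X0 \<Longrightarrow> continuous_on {(t, s). t \<ge> s} (\<lambda>(t, s). U t s x)"
  using U_family by (simp add: evolution_family_def)

lemma U_cont_left: "x \<in> X0 \<Longrightarrow> continuous_on {s..} (\<lambda>t. U t s x)"
  using solD(3)[OF U_sol] .

text \<open>The uniqueness assumption concerns half lines, so \<open>u\<close> is continued beyond
  \<open>t\<close> by the orbit of \<open>u t\<close> before it is compared with
  \<open>U\<close>.\<close>

lemma sol_homogeneous_eq:
  assumes u: "sol S (\<lambda>_. 0) u" and st: "s \<in> S" "t \<in> S" "s \<le> t"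
  shows "u t = U t s (u s)"
proof -
  define v where "v r = (if r \<le> t then u r else U r t (u t))" for r
  have X: "u s \<in> X0" "u t \<in> X0" using solD(4)[OF u] st by auto
  have v: "sol {s..} (\<lambda>_. 0) v"
  proof (rule sol_glue[where P = "{s..t}" and Q = "{t..}" and b = t])
    show "sol {s..t} (\<lambda>_. 0) v"
      by (rule sol_cong[OF sol_subset[OF u, of "{s..t}"]])
        (use interval_subset[OF solD(1)[OF u] st(1,2)] in \<open>auto simp: v_def is_interval_cc\<close>)
    show "sol {t..} (\<lambda>_. 0) v"
      by (rule sol_cong[OF U_sol[OF X(2)]]) (auto simp: v_def U_refl X)
  qed (use st in \<open>auto simp: is_interval_ci\<close>)
  have "v t = U t s (u s)"
    by (rule U_unique[OF X(1) v _ st(3)]) (simp add: v_def st)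
  then show ?thesis by (simp add: v_def)
qed

lemma sol_unique_forward:
  assumes "sol S f u" "sol S f v" "s \<in> S" "t \<in> S" "s \<le> t" "u s = v s"
  shows "u t = v t"
proof -
  have "sol S (\<lambda>_. 0) (\<lambda>r. u r - v r)" using sol_diff[OF assms(1,2)] by simp
  from sol_homogeneous_eq[OF this assms(3-5)] show ?thesis using U_0[OF assms(5)] assms(6) by simp
qed

lemma unperturbed_forcing:
  assumes g: "continuous_on {a..a + h} g" "\<And>s. s \<in> {a..a + h} \<Longrightarrow> norm (g s) \<le> M"
  shows "\<exists>u. continuous_on {a..a + h} u \<and> u ` {a..a + h} \<subseteq> X0 \<and> u a = 0 \<and>
    (\<forall>t\<in>{a..a + h}. mild a t u g \<and> norm (u t) \<le> q * M)"
proof -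
  have "continuous_on {0..h} (\<lambda>r. g (r + a))"
    by (intro continuous_on_compose2[OF g(1)] continuous_intros) auto
  then obtain u where u: "continuous_on {0..h} u" "u ` {0..h} \<subseteq> X0" "u 0 = 0"
    "\<And>t. t \<in> {0..h} \<Longrightarrow> mild 0 t u (\<lambda>r. g (r + a))" "\<And>t. t \<in> {0..h} \<Longrightarrow> norm (u t) \<le> q * M"
    using forcing[of "\<lambda>r. g (r + a)" M] g(2) by force
  have "continuous_on {a..a + h} (\<lambda>r. u (r - a))"
    by (intro continuous_on_compose2[OF u(1)] continuous_intros) auto
  moreover have "mild a t (\<lambda>r. u (r - a)) g" if "t \<in> {a..a + h}" for t
    using mild_shift[OF u(4)[of "t - a"], of a] that by simp
  ultimately show ?thesis using u(2,3,5) by (intro exI[of _ "\<lambda>r. u (r - a)"]) auto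
qed

text \<open>
  The Neumann series: \<open>d n\<close> is the unperturbed response to \<open>e n\<close>, where \<open>e 0 = f\<close> and
  \<open>e (n + 1) = B d n\<close>, so that the \<open>n\<close>-th partial sum of the \<open>d i\<close> solves the equation with
  forcing term \<open>f - e n\<close>.
\<close>

lemma forced_solution:
  assumes f: "continuous_on {a..a + h} f" "\<And>s. s \<in> {a..a + h} \<Longrightarrow> norm (f s) \<le> M"
  obtains z where "sol {a..a + h} f z" "z a = 0" "\<And>t. t \<in> {a..a + h} \<Longrightarrow> norm (z t) \<le> 2 * q * M"
proof -
  define I where "I = {a..a + h}"
  have I: "is_interval I" "a \<in> I" "I \<subseteq> {a..}" using h by (auto simp: I_def is_interval_cc)
  have M: "0 \<le> M" using order_trans[OF norm_ge_zero f(2)[of a]] h by simp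
  \<comment> \<open>The invariant for the dependent choice. Since
    \<open>q * \<beta> \<le> 1 / 2\<close>, the bound on \<open>d n\<close> halves the bound on the
    next \<open>e\<close>; the conjunct for \<open>n = 0\<close> starts the recursion at
    \<open>f\<close>.\<close>
  define P where "P n = (\<lambda>(e, d). continuous_on I e \<and> continuous_on I d \<and> d ` I \<subseteq> X0 \<and> d a = 0 \<and>
      (\<forall>t\<in>I. mild a t d e \<and> norm (e t) \<le> M * (1/2)^n \<and> norm (d t) \<le> q * M * (1/2)^n) \<and> (n = 0 \<longrightarrow> e = f))"
    for n :: nat and ed :: "(real \<Rightarrow> 'a) \<times> (real \<Rightarrow> 'a)"
  have ex: "\<exists>d. continuous_on I d \<and> d ` I \<subseteq> X0 \<and> d a = 0 \<and> (\<forall>t\<in>I. mild a t d e \<and> norm (d t) \<le> q * M * (1/2)^n)"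
    if "continuous_on I e" "\<And>t. t \<in> I \<Longrightarrow> norm (e t) \<le> M * (1/2)^n" for e and n :: nat
    using unperturbed_forcing[of a e "M * (1/2)^n"] that by (simp add: I_def mult.assoc)
  have "\<exists>ed. \<forall>n. P n (ed n) \<and> fst (ed (Suc n)) = (\<lambda>r. B r (snd (ed n) r))"
  proof (rule dependent_nat_choice)
    obtain d where "continuous_on I d" "d ` I \<subseteq> X0" "d a = 0"
      "\<forall>t\<in>I. mild a t d f \<and> norm (d t) \<le> q * M * (1/2)^0"
      using ex[of f 0] f by (auto simp: I_def)
    then show "\<exists>ed. P 0 ed" using f by (intro exI[of _ "(f, d)"]) (auto simp: P_def I_def)
    fix ed n assume ed: "P n ed"
    define e where "e = (\<lambda>r. B r (snd ed r))"
    have d: "continuous_on I (snd ed)" "snd ed ` I \<subseteq> X0" "\<And>t. t \<in> I \<Longrightarrow> norm (snd ed t) \<le> q * M * (1/2)^n"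
      using ed by (auto simp: P_def split: prod.splits)
    have e: "continuous_on I e" unfolding e_def by (intro continuous_on_B d)
    have e': "norm (e t) \<le> M * (1/2)^Suc n" if "t \<in> I" for t
    proof -
      have "norm (e t) \<le> \<beta> * norm (snd ed t)" unfolding e_def using d(2) that by (intro B_bound) auto
      also have "\<dots> \<le> \<beta> * (q * M * (1/2)^n)" using d(3)[OF that] \<beta> by (rule mult_left_mono)
      also have "\<dots> = (q * \<beta>) * (M * (1/2)^n)" by simp
      also have "\<dots> \<le> (1/2) * (M * (1/2)^n)" using q(2) M by (intro mult_right_mono) auto
      finally show ?thesis by simp
    qed
    from ex[OF e e'] obtain d' where "continuous_on I d'" "d' ` I \<subseteq> X0" "d' a = 0"
      "\<forall>t\<in>I. mild a t d' e \<and> norm (d' t) \<le> q * M * (1/2)^Suc n" by blast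
    then show "\<exists>ed'. P (Suc n) ed' \<and> fst ed' = (\<lambda>r. B r (snd ed r))"
      using e e' by (intro exI[of _ "(e, d')"]) (auto simp: P_def e_def)
  qed
  then obtain ed where ed: "\<And>n. P n (ed n)" "\<And>n. fst (ed (Suc n)) = (\<lambda>r. B r (snd (ed n) r))" by blast
  define e d where "e n = fst (ed n)" and "d n = snd (ed n)" for n
  have P: "continuous_on I (e n)" "continuous_on I (d n)" "d n ` I \<subseteq> X0" "d n a = 0"
    "\<And>t. t \<in> I \<Longrightarrow> mild a t (d n) (e n)" "\<And>t. t \<in> I \<Longrightarrow> norm (e n t) \<le> M * (1/2)^n"
    "\<And>t. t \<in> I \<Longrightarrow> norm (d n t) \<le> q * M * (1/2)^n" for n
    using ed(1)[of n] by (auto simp: P_def e_def d_def split: prod.splits)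
  have e0: "e 0 = f" using ed(1)[of 0] by (auto simp: P_def e_def split: prod.splits)
  have eS: "e (Suc n) = (\<lambda>r. B r (d n r))" for n using ed(2) by (simp add: e_def d_def)
  have dsol: "sol I (\<lambda>r. e n r - e (Suc n) r) (d n)" for n
  proof (rule sol_startI[OF I])
    show "continuous_on I (\<lambda>r. e n r - e (Suc n) r)" by (intro continuous_intros P)
    show "mild a t (d n) (\<lambda>r. B r (d n r) + (e n r - e (Suc n) r))" if "t \<in> I" for t
      using P(5)[OF that, of n] by (simp add: eS)
  qed (rule P)+
  have Ssol: "sol I (\<lambda>r. f r - e n r) (\<lambda>r. \<Sum>i<n. d i r)" for n
  proof (induction n)
    case 0
    then show ?case using sol_zero[OF I(1)] by (simp add: e0)
  next
    case (Suc n)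
    show ?case using sol_add[OF Suc dsol[of n]] by simp
  qed
  have geo: "(\<lambda>n. c * (1/2::real)^n) sums (c * 2)" for c
    using sums_mult[OF geometric_sums[of "1/2::real"]] by simp
  define z where "z r = (\<Sum>i. d i r)" for r
  have "uniform_limit I (\<lambda>n r. \<Sum>i<n. d i r) z sequentially"
    unfolding z_def by (rule Weierstrass_m_test[OF P(7)]) (use geo[of "q * M"] in \<open>auto simp: sums_iff\<close>)
  moreover have "uniform_limit I (\<lambda>n r. f r - e n r) f sequentially"
  proof (rule uniform_limitI)
    fix \<epsilon> :: real assume "\<epsilon> > 0"
    have "(\<lambda>n. M * (1/2::real)^n) \<longlonglongrightarrow> M * 0"
      by (intro tendsto_intros LIMSEQ_realpow_zero) auto
    then have "\<forall>\<^sub>F n in sequentially. M * (1/2)^n < \<epsilon>"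
      using \<open>\<epsilon> > 0\<close> by (intro order_tendstoD(2)) auto
    then show "\<forall>\<^sub>F n in sequentially. \<forall>r\<in>I. dist (f r - e n r) (f r) < \<epsilon>"
      by (rule eventually_mono) (auto simp: dist_norm intro: le_less_trans[OF P(6)])
  qed
  ultimately have "sol I f z" by (rule sol_limit[OF I(1) Ssol])
  moreover have "z a = 0" by (simp add: z_def P(4))
  moreover have "norm (z t) \<le> 2 * q * M" if "t \<in> I" for t
    using norm_suminf_le[OF P(7)[OF that] sums_summable[OF geo]] sums_unique[OF geo[of "q * M"], symmetric]
    by (simp add: z_def)
  ultimately show thesis using that unfolding I_def by blast
qed

text \<open>Uniform boundedness: the supremum \<open>p\<close> over an orbit segment is finite for
  each vector by continuity, and it is countably subadditive because every \<open>U t 0\<close> may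
  be applied to a convergent series term by term.\<close>

lemma U_bounded_from_0:
  obtains C where "0 \<le> C" "\<And>t x. x \<in> X0 \<Longrightarrow> t \<in> {0..h} \<Longrightarrow> norm (U t 0 x) \<le> C * norm x"
proof -
  define p where "p x = (SUP t\<in>{0..h}. norm (U t 0 x))" for x
  have ne: "{0..h} \<noteq> {}" using h by simp
  have up: "norm (U t 0 x) \<le> p x" if "t \<in> {0..h}" "x \<in> X0" for t x
    unfolding p_def
  proof (rule cSUP_upper[OF that(1)])
    have "continuous_on {0..h} (\<lambda>t. norm (U t 0 x))"
      by (intro continuous_intros continuous_on_subset[OF U_cont_left[OF that(2)]]) auto
    then show "bdd_above ((\<lambda>t. norm (U t 0 x)) ` {0..h})"
      by (intro bounded_imp_bdd_above compact_imp_bounded compact_continuous_image) auto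
  qed
  have least: "p x \<le> c" if "\<And>t. t \<in> {0..h} \<Longrightarrow> norm (U t 0 x) \<le> c" for x c
    unfolding p_def by (rule cSUP_least[OF ne that])
  obtain C where "0 \<le> C" "\<And>x. x \<in> X0 \<Longrightarrow> p x \<le> C * norm x"
  proof (rule bounded_of_countably_subadditive[OF X0])
    show "0 \<le> p x" if "x \<in> X0" for x
      using order_trans[OF norm_ge_zero up[of 0 x]] that h by simp
    show "p (c *\<^sub>R x) \<le> \<bar>c\<bar> * p x" if "x \<in> X0" for c x
      using up[OF _ that] that by (intro least) (auto simp: U_scaleR intro!: mult_left_mono)
    fix X :: "nat \<Rightarrow> 'a"
    assume X: "range X \<subseteq> X0" "summable (\<lambda>n. norm (X n))" "summable (\<lambda>n. p (X n))"
    show "p (suminf X) \<le> (\<Sum>n. p (X n))"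
    proof (rule least)
      fix t assume t: "t \<in> {0..h}"
      have "X sums suminf X" using summable_norm_cancel[OF X(2)] by (rule summable_sums)
      then have "(\<lambda>n. U t 0 (X n)) sums U t 0 (suminf X)"
        using t X(1) by (intro bounded_operators_sums(2)[OF U_bounded_operators X0(2)]) auto
      then show "norm (U t 0 (suminf X)) \<le> (\<Sum>n. p (X n))"
        using norm_suminf_le[OF up[OF t] X(3)] X(1) by (auto simp: sums_iff)
    qed
  qed blast
  then show thesis using that up by (meson order_trans)
qed

text \<open>
  The translate \<open>w r = U (r - s) 0 x\<close> solves the equation with \<open>B (r - s)\<close> in place of \<open>B r\<close>;
  a forced solution corrects the difference.
\<close>

lemma U_bounded:
  obtains C where "0 \<le> C" "\<And>s t x. x \<in> X0 \<Longrightarrow> s \<le> t \<Longrightarrow> t \<le> s + h \<Longrightarrow> norm (U t s x) \<le> C * norm x"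
proof -
  obtain C where C: "0 \<le> C" "\<And>t x. x \<in> X0 \<Longrightarrow> t \<in> {0..h} \<Longrightarrow> norm (U t 0 x) \<le> C * norm x"
    by (rule U_bounded_from_0) blast
  \<comment> \<open>\<open>C\<close> accounts for the translate \<open>w\<close>. The discrepancy
    between \<open>B r\<close> and \<open>B (r - s)\<close> along \<open>w\<close> is at most
    \<open>2 * \<beta> * C * norm x\<close>, and \<open>forced_solution\<close> turns it into a
    correction \<open>z\<close> with the further factor \<open>2 * q\<close>.\<close>
  have "norm (U t s x) \<le> (C + 2 * q * (2 * \<beta> * C)) * norm x" if x: "x \<in> X0" and st: "s \<le> t" "t \<le> s + h" for s t x
  proof -
    define w where "w r = U (r - s) 0 x" for r
    have c: "continuous_on {s..s + h} w"
      unfolding w_def by (intro continuous_on_compose2[OF U_cont_left[OF x]] continuous_intros) auto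
    have wX: "w r \<in> X0" if "r \<in> {s..s + h}" for r using that U_mem x by (auto simp: w_def)
    have w: "norm (w r) \<le> C * norm x" if "r \<in> {s..s + h}" for r
      using that C(2)[OF x] by (auto simp: w_def)
    have Bw: "continuous_on {s..s + h} (\<lambda>r. B r (w r))" using c wX by (intro continuous_on_B) auto
    have Bsw: "continuous_on {s..s + h} (\<lambda>r. B (r - s) (w r))"
    proof -
      have "continuous_on {0..h} (\<lambda>r. B r (U r 0 x))"
        using U_mem x by (intro continuous_on_B continuous_on_subset[OF U_cont_left[OF x]]) auto
      then show ?thesis unfolding w_def
        by (rule continuous_on_compose2) (auto intro!: continuous_intros)
    qed
    have "sol {s..s + h} (\<lambda>r. B (r - s) (w r) - B r (w r)) w"
    proof (rule sol_startI[where a = s])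
      show "mild s t w (\<lambda>r. B r (w r) + (B (r - s) (w r) - B r (w r)))" if "t \<in> {s..s + h}" for t
        using mild_shift[OF solD(5)[OF U_sol[OF x, of 0], of 0 "t - s"], of s] that by (simp add: w_def[abs_def])
    qed (use h c wX in \<open>auto intro!: continuous_intros Bw Bsw simp: is_interval_cc\<close>)
    moreover obtain z where z: "sol {s..s + h} (\<lambda>r. B r (w r) - B (r - s) (w r)) z" "z s = 0"
      "\<And>t. t \<in> {s..s + h} \<Longrightarrow> norm (z t) \<le> 2 * q * (2 * \<beta> * C * norm x)"
    proof (rule forced_solution)
      fix r assume r: "r \<in> {s..s + h}"
      have "norm (B r (w r) - B (r - s) (w r)) \<le> norm (B r (w r)) + norm (B (r - s) (w r))"
        by (rule norm_triangle_ineq4)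
      also have "\<dots> \<le> \<beta> * norm (w r) + \<beta> * norm (w r)" by (intro add_mono B_bound wX r)
      also have "\<dots> \<le> \<beta> * (C * norm x) + \<beta> * (C * norm x)" by (intro add_mono mult_left_mono w r \<beta>)
      finally show "norm (B r (w r) - B (r - s) (w r)) \<le> 2 * \<beta> * C * norm x" by (simp add: mult_ac)
    qed (use Bw Bsw in \<open>auto intro!: continuous_intros\<close>)
    ultimately have "sol {s..s + h} (\<lambda>_. 0) (\<lambda>r. w r + z r)" using sol_add by fastforce
    from sol_homogeneous_eq[OF this, of s t] have "w t + z t = U t s x"
      using st h z(2) x by (simp add: w_def U_refl)
    then have "norm (U t s x) \<le> norm (w t) + norm (z t)" by (metis norm_triangle_ineq)
    also have "\<dots> \<le> C * norm x + 2 * q * (2 * \<beta> * C * norm x)"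
      using st by (intro add_mono w z) auto
    finally show ?thesis by (simp add: algebra_simps)
  qed
  then show thesis using C(1) q \<beta> by (intro that[of "C + 2 * q * (2 * \<beta> * C)"]) auto
qed

lemma sol_UNIV_I:
  assumes "\<And>s t. s \<le> t \<Longrightarrow> sol {s..t} f u"
  shows "sol UNIV f u"
  unfolding sol_def
proof (intro conjI ballI impI)
  have "isCont f x \<and> isCont u x" for x
    using solD(2,3)[OF assms[of "x - 1" "x + 1"]]
    by (auto intro: continuous_on_interior[of "{x - 1..x + 1}"] simp: interior_atLeastAtMost_real)
  then show "continuous_on UNIV f" "continuous_on UNIV u"
    by (auto simp: continuous_on_eq_continuous_at)
  show "u ` UNIV \<subseteq> X0" using solD(4)[OF assms[OF order_refl]] by auto
  show "mild s t u (\<lambda>r. B r (u r) + f r)" if "s \<le> t" for s t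
    using solD(5)[OF assms[OF that]] that by simp
qed (rule is_interval_univ)

end

subsection \<open>Dichotomy implies admissibility\<close>

lemma le_zero_of_exp_decay:
  fixes x c b :: real
  assumes "b > 0" "\<And>n. x \<le> c * exp (- b * real n)"
  shows "x \<le> 0"
proof -
  have "(\<lambda>n. c * exp (- b) ^ n) \<longlonglongrightarrow> c * 0"
    using assms(1) by (intro tendsto_intros LIMSEQ_realpow_zero) auto
  moreover have "exp (- b * real n) = exp (- b) ^ n" for n
    by (rule exp_of_nat2_mult)
  ultimately show ?thesis using assms(2) LIMSEQ_le_const[of _ 0 x] by auto
qed

lemma bcontfunD:
  assumes "f \<in> bcontfun"
  obtains M where "continuous_on UNIV f" "0 \<le> M" "\<And>x. norm (f x) \<le> M"
proof -
  obtain M where "\<And>x. norm (f x) \<le> M"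
    using assms by (auto simp: bcontfun_def bounded_iff)
  then show thesis using assms that[of M] order_trans[OF norm_ge_zero] by (auto simp: bcontfun_def)
qed

context perturbed_family
begin

text \<open>On the grid the problem becomes the recursion \<open>yrec\<close> with jumps in
  \<open>X0\<close>, where the projections apply. Its bounded solution is a two-sided geometric
  series, and the cells between grid points are filled by local solutions.\<close>

lemma dichotomy_imp_admissible:
  assumes dich: "exponential_dichotomy_with X0 U \<kappa> b" and \<kappa>: "\<kappa> \<ge> 1" and b: "b > 0" and f: "f \<in> bcontfun"
  shows "\<exists>!u. u \<in> bcontfun \<and> sol UNIV f u"
proof -
  obtain Pp Pm :: "real \<Rightarrow> 'a \<Rightarrow> 'a" where
    P: "\<forall>t. bounded_projection X0 (Pp t) \<and> bounded_projection X0 (Pm t)"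
      "\<forall>t. \<forall>x\<in>X0. Pp t x + Pm t x = x"
      "\<forall>t s. t \<ge> s \<longrightarrow> (\<forall>x\<in>X0. Pp t (U t s x) = U t s (Pp s x))"
      "\<forall>t s. t \<ge> s \<longrightarrow> bij_betw (U t s) (Pm s ` X0) (Pm t ` X0)"
      "\<forall>t s. t \<ge> s \<longrightarrow> opnorm_le X0 (U t s \<circ> Pp s) (\<kappa> * exp (- b * (t - s))) \<and>
        opnorm_le X0 (inv_into (Pm s ` X0) (U t s) \<circ> Pm t) (\<kappa> * exp (- b * (t - s)))"
    using dich unfolding exponential_dichotomy_with_def by (elim exE conjE) (rule that; assumption)
  have proj: "bounded_projection X0 (Pp t)" "bounded_projection X0 (Pm t)" for t
    using P(1) by simp_all
  have Psum: "Pp t x + Pm t x = x" if "x \<in> X0" for t x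
    using P(2) that by simp
  have comm: "Pp t (U t s x) = U t s (Pp s x)" if "s \<le> t" "x \<in> X0" for s t x
    using P(3) that by simp
  have bij: "bij_betw (U t s) (Pm s ` X0) (Pm t ` X0)" if "s \<le> t" for s t
    using P(4) that by simp
  have Pp_bd: "opnorm_le X0 (U t s \<circ> Pp s) (\<kappa> * exp (- b * (t - s)))"
    and Pm_bd: "opnorm_le X0 (inv_into (Pm s ` X0) (U t s) \<circ> Pm t) (\<kappa> * exp (- b * (t - s)))"
    if "s \<le> t" for s t
    using P(5) that by simp_all
  have mem: "Pp t x \<in> X0" "Pm t x \<in> X0" if "x \<in> X0" for t x
    using proj that bounded_operatorsD(3) by (metis bounded_projection_def)+
  have commm: "Pm t (U t s x) = U t s (Pm s x)" if "s \<le> t" "x \<in> X0" for s t x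
  proof -
    have "U t s (Pp s x) + Pm t (U t s x) = U t s (Pp s x) + U t s (Pm s x)"
      using Psum[of "U t s x" t] comm[OF that] U_mem[OF that] Psum[OF that(2), of s]
        U_add[OF that(1) mem(1)[OF that(2)] mem(2)[OF that(2)], of s s] by simp
    then show ?thesis by simp
  qed
  \<comment> \<open>The backward operator \<open>U^-(s,t)\<close> of the dichotomy;
    \<open>V_eq\<close> characterises its values by membership in the range of \<open>Pm s\<close>
    and by their image under \<open>U t s\<close>.\<close>
  define V where "V s t x = inv_into (Pm s ` X0) (U t s) (Pm t x)" for s t x
  have V: "V s t x \<in> Pm s ` X0" "V s t x \<in> X0" "U t s (V s t x) = Pm t x"
    "norm (V s t x) \<le> \<kappa> * exp (- b * (t - s)) * norm x" if "s \<le> t" "x \<in> X0" for s t x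
  proof -
    have im: "Pm t x \<in> U t s ` Pm s ` X0"
      unfolding bij_betw_imp_surj_on[OF bij[OF that(1)]] using that(2) by (rule imageI)
    show 1: "V s t x \<in> Pm s ` X0" unfolding V_def by (rule inv_into_into[OF im])
    then show "V s t x \<in> X0" using mem(2) by auto
    show "U t s (V s t x) = Pm t x" unfolding V_def by (rule f_inv_into_f[OF im])
    show "norm (V s t x) \<le> \<kappa> * exp (- b * (t - s)) * norm x"
      using Pm_bd[OF that(1)] that(2) by (simp add: opnorm_le_def V_def)
  qed
  have V_eq: "y = V s t x" if "s \<le> t" "x \<in> X0" "y \<in> Pm s ` X0" "U t s y = Pm t x" for s t x y
    using inj_onD[OF bij_betw_imp_inj_on[OF bij[OF that(1)]] _ that(3) V(1)[OF that(1,2)]] V(3)[OF that(1,2)] that(4)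
    by simp
  have UV: "U r s (V s t x) = V r t x" if "s \<le> r" "r \<le> t" "x \<in> X0" for s r t x
  proof (rule V_eq[OF that(2,3)])
    show "U r s (V s t x) \<in> Pm r ` X0"
      using bij_betw_apply[OF bij[OF that(1)] V(1)[of s t x]] that by simp
    show "U t r (U r s (V s t x)) = Pm t x"
      using that V(2,3)[of s t x] by (simp add: U_trans)
  qed
  have VV: "V t t x = Pm t x" if "x \<in> X0" for t x
    using V(3)[of t t x] V(2)[of t t x] that by (simp add: U_refl)
  have U_bd: "norm (U t s (Pp s x)) \<le> \<kappa> * exp (- b * (t - s)) * norm x" if "s \<le> t" "x \<in> X0" for s t x
    using Pp_bd[OF that(1)] that(2) by (simp add: opnorm_le_def)

  \<comment> \<open>The stable component of \<open>w t\<close> arrives from time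
    \<open>t - n\<close>, the unstable one is recovered from time \<open>t + n\<close>. Both routes
    cost a factor \<open>exp (- b * n)\<close> while \<open>w\<close> stays bounded.\<close>
  have unique: "w t = 0" if w: "sol UNIV (\<lambda>_. 0) w" and N: "\<And>t. norm (w t) \<le> N" for w N t
  proof -
    have X: "w t \<in> X0" for t using solD(4)[OF w] by simp
    have Uw: "U t s (w s) = w t" if "s \<le> t" for s t using sol_homogeneous_eq[OF w _ _ that] by simp
    have 1: "norm (Pp t (w t)) \<le> (\<kappa> * N) * exp (- b * real n)" for n
    proof -
      have "Pp t (w t) = U t (t - n) (Pp (t - n) (w (t - n)))"
        using comm[of "t - n" t "w (t - n)"] Uw[of "t - n" t] X by simp
      then have "norm (Pp t (w t)) \<le> \<kappa> * exp (- b * (t - (t - n))) * norm (w (t - n))"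
        using U_bd[of "t - n" t] X by simp
      also have "\<dots> \<le> \<kappa> * exp (- b * (t - (t - n))) * N" using \<kappa> by (intro mult_left_mono N) auto
      finally show ?thesis by (simp add: mult_ac)
    qed
    have 2: "norm (Pm t (w t)) \<le> (\<kappa> * N) * exp (- b * real n)" for n
    proof -
      have "Pm t (w t) = V t (t + n) (w (t + n))"
        by (rule V_eq) (use X commm[of t "t + n" "w t"] Uw[of t "t + n"] in simp_all)
      then have "norm (Pm t (w t)) \<le> \<kappa> * exp (- b * (t + n - t)) * norm (w (t + n))"
        using V(4)[of t "t + n"] X by simp
      also have "\<dots> \<le> \<kappa> * exp (- b * (t + n - t)) * N" using \<kappa> by (intro mult_left_mono N) auto
      finally show ?thesis by (simp add: mult_ac)
    qed
    have "norm (Pp t (w t)) \<le> 0" "norm (Pm t (w t)) \<le> 0"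
      using le_zero_of_exp_decay[OF b 1] le_zero_of_exp_decay[OF b 2] by simp_all
    then show ?thesis using Psum[OF X, of t t] by simp
  qed

  obtain M where M: "continuous_on UNIV f" "0 \<le> M" "\<And>x. norm (f x) \<le> M" using bcontfunD[OF f] by metis
  define \<tau> where "\<tau> n = real_of_int n * h" for n
  have \<tau>: "\<tau> (n + 1) = \<tau> n + h" "\<tau> (n + int k) - \<tau> n = real k * h" "\<tau> n - \<tau> (n - int k) = real k * h"
    "\<tau> (n - int k) \<le> \<tau> n" "\<tau> n \<le> \<tau> (n + int k)" "m \<le> n \<Longrightarrow> \<tau> m \<le> \<tau> n" for n m k
    using h by (auto simp: \<tau>_def algebra_simps)
  have "\<forall>n. \<exists>z. sol {\<tau> n..\<tau> n + h} f z \<and> z (\<tau> n) = 0 \<and> (\<forall>t\<in>{\<tau> n..\<tau> n + h}. norm (z t) \<le> 2 * q * M)"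
    using forced_solution[OF continuous_on_subset[OF M(1) subset_UNIV] M(3)] by metis
  then obtain z where z: "\<And>n. sol {\<tau> n..\<tau> n + h} f (z n)" "\<And>n. z n (\<tau> n) = 0"
    "\<And>n t. t \<in> {\<tau> n..\<tau> n + h} \<Longrightarrow> norm (z n t) \<le> 2 * q * M" by metis
  define G where "G = 2 * q * M"
  \<comment> \<open>The end value, at \<open>\<tau> n\<close>, of the local solution on the cell to
    its left: the part of the forcing that has reached \<open>X0\<close>.\<close>
  define g where "g n = z (n - 1) (\<tau> n)" for n
  have g: "g n \<in> X0" "norm (g n) \<le> G" for n
    using z(3)[of "\<tau> n" "n - 1"] solD(4)[OF z(1)[of "n - 1"], of "\<tau> n"] h \<tau>(1)[of "n - 1"]
    by (auto simp: g_def G_def)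
  have G: "0 \<le> G" using M q by (simp add: G_def)

  \<comment> \<open>The offsets differ on purpose: \<open>ps\<close> includes the jump at
    \<open>\<tau> n\<close> itself, whereas \<open>qs\<close> begins with the next grid point.
    Advancing by one cell thus releases \<open>Pp\<close> of the new jump from one series and
    \<open>Pm\<close> of it from the other, and these add up to the full jump in
    \<open>yrec\<close>.\<close>
  define ps where "ps n j = U (\<tau> n) (\<tau> (n - int j)) (Pp (\<tau> (n - int j)) (g (n - int j)))" for n j
  define qs where "qs n j = V (\<tau> n) (\<tau> (n + int (Suc j))) (g (n + int (Suc j)))" for n j
  have geo: "summable (\<lambda>j. \<kappa> * G * exp (- b * h) ^ j)"
    using b h by (intro summable_mult summable_geometric) simp
  have exp_eq: "exp (- b * (real j * h)) = exp (- b * h) ^ j" for j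
    using exp_of_nat2_mult[of "- b * h" j] by (simp add: mult_ac)
  have ps: "ps n j \<in> X0" "norm (ps n j) \<le> \<kappa> * G * exp (- b * h) ^ j" for n j
  proof -
    show "ps n j \<in> X0" unfolding ps_def by (intro U_mem mem g \<tau>)
    have "norm (ps n j) \<le> \<kappa> * exp (- b * (\<tau> n - \<tau> (n - int j))) * norm (g (n - int j))"
      unfolding ps_def by (intro U_bd \<tau> g)
    also have "\<dots> \<le> \<kappa> * exp (- b * (\<tau> n - \<tau> (n - int j))) * G" using \<kappa> by (intro mult_left_mono g) auto
    finally show "norm (ps n j) \<le> \<kappa> * G * exp (- b * h) ^ j" unfolding \<tau>(3) exp_eq by (simp add: mult_ac)
  qed
  have qs: "qs n j \<in> X0" "norm (qs n j) \<le> \<kappa> * G * exp (- b * h) ^ j" for n j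
  proof -
    show "qs n j \<in> X0" unfolding qs_def by (intro V \<tau> g)
    have "norm (qs n j) \<le> \<kappa> * exp (- b * (\<tau> (n + int (Suc j)) - \<tau> n)) * norm (g (n + int (Suc j)))"
      unfolding qs_def by (intro V \<tau> g)
    also have "\<dots> \<le> \<kappa> * exp (- b * (\<tau> (n + int (Suc j)) - \<tau> n)) * G" using \<kappa> by (intro mult_left_mono g) auto
    also have "\<dots> = \<kappa> * G * exp (- b * h) ^ Suc j" unfolding \<tau>(2) exp_eq by (simp add: mult_ac)
    also have "\<dots> \<le> \<kappa> * G * exp (- b * h) ^ j" using \<kappa> G b h by (intro mult_left_mono power_decreasing) auto
    finally show "norm (qs n j) \<le> \<kappa> * G * exp (- b * h) ^ j" .
  qed
  define p r where "p n = suminf (ps n)" and "r n = suminf (qs n)" for n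
  define N where "N = (\<Sum>j. \<kappa> * G * exp (- b * h) ^ j)"
  have pN: "norm (p n) \<le> N" "norm (r n) \<le> N" for n
    unfolding p_def r_def N_def by (intro norm_suminf_le ps qs geo)+
  have psums: "ps n sums p n" "qs n sums r n" for n
    unfolding p_def r_def by (intro summable_sums summable_comparison_test'[OF geo] ps qs)+
  have pX: "p n \<in> X0" "r n \<in> X0" for n
    using bounded_operators_sums(1)[OF U_bounded_operators[OF order_refl] X0(2)] ps(1) qs(1) psums by blast+
  have prec: "U (\<tau> (n + 1)) (\<tau> n) (p n) = p (n + 1) - Pp (\<tau> (n + 1)) (g (n + 1))" for n
  proof -
    have "\<tau> n \<le> \<tau> (n + 1)" using h by (simp add: \<tau>)
    then have "(\<lambda>j. U (\<tau> (n + 1)) (\<tau> n) (ps n j)) sums U (\<tau> (n + 1)) (\<tau> n) (p n)"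
      by (intro bounded_operators_sums(2)[OF U_bounded_operators X0(2)] ps psums)
    moreover have "U (\<tau> (n + 1)) (\<tau> n) (ps n j) = ps (n + 1) (Suc j)" for j
      using \<open>\<tau> n \<le> \<tau> (n + 1)\<close> \<tau>(4)[of n j] mem g by (simp add: ps_def U_trans)
    ultimately have "(\<lambda>j. ps (n + 1) (Suc j)) sums U (\<tau> (n + 1)) (\<tau> n) (p n)" by simp
    then have "ps (n + 1) sums (U (\<tau> (n + 1)) (\<tau> n) (p n) + ps (n + 1) 0)" by (rule sums_Suc)
    then have "p (n + 1) = U (\<tau> (n + 1)) (\<tau> n) (p n) + ps (n + 1) 0" using psums(1) by (rule sums_unique2[symmetric])
    moreover have "ps (n + 1) 0 = Pp (\<tau> (n + 1)) (g (n + 1))" using mem g by (simp add: ps_def U_refl)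
    ultimately show ?thesis by simp
  qed
  have rrec: "U (\<tau> (n + 1)) (\<tau> n) (r n) = r (n + 1) + Pm (\<tau> (n + 1)) (g (n + 1))" for n
  proof -
    define F where "F j = U (\<tau> (n + 1)) (\<tau> n) (qs n j)" for j
    have le: "\<tau> n \<le> \<tau> (n + 1)" using h by (simp add: \<tau>)
    then have "F sums U (\<tau> (n + 1)) (\<tau> n) (r n)"
      unfolding F_def by (intro bounded_operators_sums(2)[OF U_bounded_operators X0(2)] qs psums)
    moreover have F: "F j = V (\<tau> (n + 1)) (\<tau> (n + int (Suc j))) (g (n + int (Suc j)))" for j
      unfolding F_def qs_def by (intro UV le g \<tau>(6)) simp
    have "F (Suc j) = qs (n + 1) j" for j
      unfolding F qs_def by (simp add: add_ac)
    then have "F sums (r (n + 1) + F 0)" using psums(2)[of "n + 1"] sums_Suc[of F] by simp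
    ultimately have "U (\<tau> (n + 1)) (\<tau> n) (r n) = r (n + 1) + F 0" by (rule sums_unique2)
    then show ?thesis unfolding F by (simp add: VV g)
  qed
  define y where "y n = p n - r n" for n
  have yX: "y n \<in> X0" for n using pX X0_closed_ops by (simp add: y_def)
  have yN: "norm (y n) \<le> 2 * N" for n
    using norm_triangle_ineq4[of "p n" "r n"] pN[of n] unfolding y_def by linarith
  have yrec: "y (n + 1) = U (\<tau> (n + 1)) (\<tau> n) (y n) + g (n + 1)" for n
  proof -
    have "U (\<tau> (n + 1)) (\<tau> n) (y n) = U (\<tau> (n + 1)) (\<tau> n) (p n) - U (\<tau> (n + 1)) (\<tau> n) (r n)"
      unfolding y_def using h by (intro U_diff pX) (simp add: \<tau>)
    also have "\<dots> = p (n + 1) - r (n + 1) - (Pp (\<tau> (n + 1)) (g (n + 1)) + Pm (\<tau> (n + 1)) (g (n + 1)))"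
      unfolding prec rrec by simp
    finally show ?thesis unfolding Psum[OF g(1)] by (simp add: y_def)
  qed

  define u where "u t = U t (\<tau> \<lfloor>t / h\<rfloor>) (y \<lfloor>t / h\<rfloor>) + z \<lfloor>t / h\<rfloor> t" for t
  \<comment> \<open>The floor function assigns the right end point of a cell to the next cell. There
    \<open>yrec\<close> and the zero initial value of the next local solution make both formulas
    agree, which allows gluing over closed cells.\<close>
  have u_eq: "u t = U t (\<tau> n) (y n) + z n t" if "t \<in> {\<tau> n..\<tau> n + h}" for t n
  proof (cases "t = \<tau> n + h")
    case True
    then have "t / h = real_of_int (n + 1)" using h by (simp add: \<tau>_def field_simps)
    then have "\<lfloor>t / h\<rfloor> = n + 1" by (metis floor_of_int)
    then have "u t = y (n + 1)" using z(2)[of "n + 1"] True by (simp add: u_def \<tau> U_refl yX flip: \<tau>(1))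
    then show ?thesis using yrec[of n] True by (simp add: g_def \<tau>)
  next
    case False
    then have "\<lfloor>t / h\<rfloor> = n" using that h by (intro floor_unique) (auto simp: \<tau>_def field_simps)
    then show ?thesis by (simp add: u_def)
  qed
  have sol1: "sol {\<tau> n..\<tau> (n + 1)} f u" for n
  proof (rule sol_cong)
    show "sol {\<tau> n..\<tau> (n + 1)} (\<lambda>r. 0 + f r) (\<lambda>r. U r (\<tau> n) (y n) + z n r)"
      by (rule sol_add[OF sol_subset[OF U_sol[OF yX]]]) (use z(1)[of n] in \<open>auto simp: \<tau> is_interval_cc\<close>)
  qed (auto simp: u_eq \<tau>)
  have solk: "sol {\<tau> n..\<tau> (n + int k)} f u" for n k
  proof (induction k)
    case 0
    show ?case by (rule sol_subset[OF sol1[of n] is_interval_cc]) (use h in \<open>auto simp: \<tau>\<close>)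
  next
    case (Suc k)
    have *: "\<tau> n \<le> \<tau> (n + int k)" "\<tau> (n + int k) \<le> \<tau> (n + int k + 1)" by (intro \<tau>(6); simp)+
    show ?case
      by (rule sol_glue[OF Suc sol1[of "n + int k"], where b = "\<tau> (n + int k)"])
        (use * in \<open>auto simp: is_interval_cc add_ac\<close>)
  qed
  have "sol UNIV f u"
  proof (rule sol_UNIV_I)
    fix s t :: real assume "s \<le> t"
    obtain m where m: "\<bar>s\<bar> / h + \<bar>t\<bar> / h \<le> real m" using real_arch_simple by blast
    then have "\<bar>s\<bar> + \<bar>t\<bar> \<le> real m * h" using h by (simp add: field_simps)
    then have "{s..t} \<subseteq> {\<tau> (- int m)..\<tau> (- int m + int (2 * m))}" by (auto simp: \<tau>_def)
    then show "sol {s..t} f u" by (rule sol_subset[OF solk is_interval_cc])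
  qed
  moreover have "u \<in> bcontfun"
  proof -
    obtain C where C: "0 \<le> C" "\<And>s t x. x \<in> X0 \<Longrightarrow> s \<le> t \<Longrightarrow> t \<le> s + h \<Longrightarrow> norm (U t s x) \<le> C * norm x"
      using U_bounded by blast
    have "norm (u t) \<le> C * (2 * N) + 2 * q * M" for t
    proof -
      define n where "n = \<lfloor>t / h\<rfloor>"
      have "of_int n \<le> t / h" "t / h < of_int n + 1" unfolding n_def by linarith+
      then have n: "t \<in> {\<tau> n..\<tau> n + h}" using h by (auto simp: \<tau>_def field_simps)
      have "norm (u t) \<le> norm (U t (\<tau> n) (y n)) + norm (z n t)"
        unfolding u_eq[OF n] by (rule norm_triangle_ineq)
      also have "\<dots> \<le> C * norm (y n) + 2 * q * M" using n by (intro add_mono C yX z(3)) auto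
      also have "\<dots> \<le> C * (2 * N) + 2 * q * M" using C(1) yN by (intro add_right_mono mult_left_mono)
      finally show ?thesis .
    qed
    then show ?thesis using solD(3)[OF \<open>sol UNIV f u\<close>] by (intro bcontfun_normI)
  qed
  moreover have "v = u" if v: "v \<in> bcontfun" "sol UNIV f v" for v
  proof
    fix t
    have "(\<lambda>r. v r - u r) \<in> bcontfun" using v(1) \<open>u \<in> bcontfun\<close> by (rule minus_cont)
    then obtain N' where "\<And>r. norm (v r - u r) \<le> N'" using bcontfunD by blast
    moreover have "sol UNIV (\<lambda>_. 0) (\<lambda>r. v r - u r)" using sol_diff[OF v(2) \<open>sol UNIV f u\<close>] by simp
    ultimately have "v t - u t = 0" by (intro unique)
    then show "v t = u t" by simp
  qed
  ultimately show ?thesis by blast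
qed

end

subsection \<open>The bounded solution operator\<close>

lemma has_real_derivative_max_0_power2:
  "((\<lambda>x::real. (max 0 x)\<^sup>2) has_real_derivative 2 * max 0 x) (at x)"
proof -
  consider "x > 0" | "x < 0" | "x = 0" by linarith
  then show ?thesis
  proof cases
    case 1
    have "((\<lambda>x::real. x\<^sup>2) has_real_derivative 2 * max 0 x) (at x)"
      using 1 by (auto intro!: derivative_eq_intros)
    then show ?thesis
      by (rule has_field_derivative_transform_within_open[where S = "{0<..}"]) (use 1 in auto)
  next
    case 2
    have "((\<lambda>x::real. 0) has_real_derivative 2 * max 0 x) (at x)"
      using 2 by simp
    then show ?thesis
      by (rule has_field_derivative_transform_within_open[where S = "{..<0}"]) (use 2 in auto)
  next
    case 3
    have "((\<lambda>y::real. (max 0 y)\<^sup>2 / y) \<longlongrightarrow> 0) (at 0)"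
    proof (rule Lim_null_comparison[where g = "\<lambda>y. norm y"])
      show "\<forall>\<^sub>F y::real in at 0. norm ((max 0 y)\<^sup>2 / y) \<le> norm y"
        by (intro always_eventually allI) (auto simp: max_def power2_eq_square)
      show "((\<lambda>y. norm y) \<longlongrightarrow> (0::real)) (at 0)"
        by (rule tendsto_norm_zero[OF tendsto_ident_at])
    qed
    then show ?thesis using 3 by (simp add: has_field_derivative_iff)
  qed
qed

text \<open>\<open>\<phi>\<close> is the tent of height \<open>2 / h\<close> over
  \<open>[0, h]\<close>, written as a second difference of ramps; then \<open>a\<close> is the same
  combination of squared ramps. The unit area of the tent gives \<open>a r = 1\<close> beyond
  \<open>h\<close>, and \<open>c\<close> is the crude bound \<open>4 / h\<close>.\<close>

lemma bump_function:
  fixes h :: real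
  assumes h: "0 < h"
  obtains \<phi> a :: "real \<Rightarrow> real" and c where
    "continuous_on UNIV \<phi>" "\<And>r. r \<le> 0 \<Longrightarrow> \<phi> r = 0" "\<And>r. r \<ge> h \<Longrightarrow> \<phi> r = 0"
    "0 \<le> c" "\<And>r. \<bar>\<phi> r\<bar> \<le> c" "\<And>r. (a has_real_derivative \<phi> r) (at r)"
    "a 0 = 0" "\<And>r. r \<ge> h \<Longrightarrow> a r = 1"
proof -
  define \<phi> where "\<phi> r = 4 / h\<^sup>2 * (max 0 r - 2 * max 0 (r - h/2) + max 0 (r - h))" for r
  define a where "a r = 2 / h\<^sup>2 * ((max 0 r)\<^sup>2 - 2 * (max 0 (r - h/2))\<^sup>2 + (max 0 (r - h))\<^sup>2)" for r
  show thesis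
  proof (rule that[of \<phi> "4 / h\<^sup>2 * h" a])
    show "continuous_on UNIV \<phi>" unfolding \<phi>_def by (intro continuous_intros)
    show "\<phi> r = 0" if "r \<le> 0" for r using that h by (simp add: \<phi>_def)
    show "\<phi> r = 0" if "r \<ge> h" for r using that h by (simp add: \<phi>_def)
    show "0 \<le> 4 / h\<^sup>2 * h" using h by simp
    show "\<bar>\<phi> r\<bar> \<le> 4 / h\<^sup>2 * h" for r
    proof -
      have "\<bar>max 0 r - 2 * max 0 (r - h/2) + max 0 (r - h)\<bar> \<le> h" using h by (auto simp: max_def)
      then show ?thesis unfolding \<phi>_def abs_mult using h by (simp add: divide_right_mono)
    qed
    show "(a has_real_derivative \<phi> r) (at r)" for r
    proof -
      have 1: "((\<lambda>r. (max 0 (r - c))\<^sup>2) has_real_derivative 2 * max 0 (r - c)) (at r)" for c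
      proof -
        have "((\<lambda>r. r - c) has_real_derivative 1) (at r)" by (auto intro!: derivative_eq_intros)
        from DERIV_chain2[OF has_real_derivative_max_0_power2 this] show ?thesis by simp
      qed
      show ?thesis
        unfolding a_def[abs_def]
        by (rule DERIV_cong[OF DERIV_cmult[OF DERIV_add[OF DERIV_diff[OF
              has_real_derivative_max_0_power2 DERIV_cmult[OF 1[of "h/2"], of 2]] 1[of h]], of "2 / h\<^sup>2"]])
          (simp add: \<phi>_def algebra_simps add_divide_distrib diff_divide_distrib)
    qed
    show "a 0 = 0" using h by (simp add: a_def)
    show "a r = 1" if "r \<ge> h" for r
      using that h by (simp add: a_def field_simps power2_eq_square)
  qed
qed

instance bcontfun :: (metric_space, banach) banach ..

locale admissible_family = perturbed_family +
  assumes admissible: "\<And>f :: real \<Rightarrow> 'a. f \<in> bcontfun \<Longrightarrow> \<exists>!u. u \<in> bcontfun \<and> sol UNIV f u"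
begin

lemma bounded_solution_unique:
  "u \<in> bcontfun \<Longrightarrow> sol UNIV f u \<Longrightarrow> v \<in> bcontfun \<Longrightarrow> sol UNIV f v \<Longrightarrow> f \<in> bcontfun \<Longrightarrow> u = v"
  using admissible by blast

lemma bounded_homogeneous_solution_0:
  assumes u: "sol UNIV (\<lambda>_. 0) u" and c: "\<And>t. norm (u t) \<le> c"
  shows "u t = 0"
proof -
  have "u \<in> bcontfun" using solD(3)[OF u] c by (rule bcontfun_normI)
  then have "u = (\<lambda>_. 0)"
    by (rule bounded_solution_unique[OF _ u const_bcontfun sol_zero const_bcontfun]) (rule is_interval_univ)
  then show ?thesis by simp
qed

text \<open>The closed graph theorem: the solution map \<open>G\<close> is linear by uniqueness, and
  \<open>sol_limit\<close> closes its graph under uniform limits, so \<open>norm (G F)\<close> is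
  countably subadditive on the Banach space of bounded continuous functions.\<close>

lemma bounded_solution_bound:
  obtains K where "0 < K" "\<And>f u M t. sol UNIV f u \<Longrightarrow> u \<in> bcontfun \<Longrightarrow> f \<in> bcontfun \<Longrightarrow>
    (\<And>t. norm (f t) \<le> M) \<Longrightarrow> norm (u t) \<le> K * M"
proof -
  have "\<exists>V. sol UNIV (apply_bcontfun F) (apply_bcontfun V)" for F :: "real \<Rightarrow>\<^sub>C 'a"
    using admissible[OF apply_bcontfun, of F] by (metis bcontfunE)
  then obtain G where G: "\<And>F. sol UNIV (apply_bcontfun F) (apply_bcontfun (G F))" by metis
  have G_eq: "G F = V" if "sol UNIV (apply_bcontfun F) (apply_bcontfun V)" for F V
    using bounded_solution_unique[OF apply_bcontfun G apply_bcontfun that apply_bcontfun]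
    by (simp add: apply_bcontfun_inject)
  have G_add: "G (F + F') = G F + G F'" for F F'
    using sol_add[OF G[of F] G[of F']] by (intro G_eq) (simp add: plus_bcontfun.rep_eq)
  have G_scaleR: "G (c *\<^sub>R F) = c *\<^sub>R G F" for c F
    using sol_scaleR[OF G[of F], of c] by (intro G_eq) (simp add: scaleR_bcontfun.rep_eq)
  have G_sum: "G (\<Sum>i<n. X i) = (\<Sum>i<n. G (X i))" for n :: nat and X
    by (induction n) (use G_scaleR[of 0 0] in \<open>simp_all add: G_add\<close>)
  obtain K where K: "0 \<le> K" "\<And>F. norm (G F) \<le> K * norm F"
  proof (rule bounded_of_countably_subadditive[of UNIV "\<lambda>F. norm (G F)"])
    fix X :: "nat \<Rightarrow> real \<Rightarrow>\<^sub>C 'a"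
    assume X: "summable (\<lambda>n. norm (X n))" "summable (\<lambda>n. norm (G (X n)))"
    have "uniform_limit UNIV (\<lambda>n. apply_bcontfun (\<Sum>i<n. X i)) (apply_bcontfun (suminf X)) sequentially"
      using summable_LIMSEQ[OF summable_norm_cancel[OF X(1)]] by (rule tendsto_bcontfun_uniform_limit)
    moreover have "uniform_limit UNIV (\<lambda>n. apply_bcontfun (\<Sum>i<n. G (X i))) (apply_bcontfun (\<Sum>i. G (X i))) sequentially"
      using summable_LIMSEQ[OF summable_norm_cancel[OF X(2)]] by (rule tendsto_bcontfun_uniform_limit)
    ultimately have "G (suminf X) = (\<Sum>i. G (X i))"
      by (intro G_eq sol_limit[OF is_interval_univ G[of "\<Sum>i<n. X i" for n, unfolded G_sum]])
    then show "norm (G (suminf X)) \<le> (\<Sum>n. norm (G (X n)))"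
      using summable_norm[OF X(2)] by simp
  qed (auto simp: G_scaleR)
  show thesis
  \<comment> \<open>Adding 1 makes the constant strictly positive, so that its reciprocal can serve
    as a decay rate.\<close>
  proof (rule that[of "K + 1"])
    fix f u :: "real \<Rightarrow> 'a" and M t
    assume u: "sol UNIV f u" "u \<in> bcontfun" and f: "f \<in> bcontfun" "\<And>t. norm (f t) \<le> M"
    obtain F V where FV: "f = apply_bcontfun F" "u = apply_bcontfun V" using f u bcontfunE by metis
    then have "norm V \<le> K * norm F" using K(2)[of F] G_eq[of F V] u by simp
    also have "\<dots> \<le> K * M" using f(2) K(1) unfolding FV by (intro mult_left_mono norm_bound)
    also have "\<dots> \<le> (K + 1) * M"
      using order_trans[OF norm_ge_zero f(2)] by (simp add: distrib_right)
    finally show "norm (u t) \<le> (K + 1) * M" using norm_bounded[of V t] FV by simp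
  qed (use K in simp)
qed

text \<open>
  The weight \<open>\<psi> r = 1 / (\<epsilon> + exp (- c (r - s)))\<close> is bounded and satisfies \<open>\<bar>\<psi>'\<bar> \<le> \<bar>c\<bar> \<psi>\<close>, so \<open>\<psi> u\<close> is
  a bounded solution for the forcing term \<open>\<psi> f + \<psi>' u\<close>, whose second part is absorbed if \<open>\<bar>c\<bar>\<close> is small.
\<close>

lemma weighted_solution_bound:
  assumes K: "0 < K" "\<And>f u M t. sol UNIV f u \<Longrightarrow> u \<in> bcontfun \<Longrightarrow> f \<in> bcontfun \<Longrightarrow>
      (\<And>t. norm (f t) \<le> M) \<Longrightarrow> norm (u t) \<le> K * M"
    and c: "K * \<bar>c\<bar> \<le> 1 / 2"
    and u: "sol UNIV f u" "u \<in> bcontfun"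
    and M: "\<And>r. norm (f r) \<le> M * exp (- c * (r - s))"
  shows "norm (u t) \<le> 2 * K * M * exp (- c * (t - s))"
proof -
  define E where "E r = exp (- c * (r - s))" for r
  have E: "E r > 0" for r by (simp add: E_def)
  have M0: "0 \<le> M" using order_trans[OF norm_ge_zero M[of s]] by simp
  \<comment> \<open>The pure weight \<open>1 / E\<close> is unbounded; a positive
    \<open>\<epsilon>\<close> makes \<open>\<psi> u\<close> a bounded function to which
    \<open>K\<close> applies. The resulting estimate of \<open>\<psi> u\<close> does not depend on
    \<open>\<epsilon>\<close>, which may therefore tend to 0 at the end.\<close>
  have *: "norm (u t) \<le> (\<epsilon> + E t) * (2 * K * M)" if \<epsilon>: "\<epsilon> > 0" for \<epsilon>
  proof -
    define \<psi> \<psi>' where "\<psi> r = 1 / (\<epsilon> + E r)" and "\<psi>' r = c * E r / (\<epsilon> + E r)\<^sup>2" for r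
    have pos: "\<epsilon> + E r > 0" for r using E[of r] \<epsilon> by simp
    have \<psi>: "0 < \<psi> r" "\<psi> r \<le> 1 / \<epsilon>" "\<bar>\<psi>' r\<bar> \<le> \<bar>c\<bar> * \<psi> r" "\<psi> r * E r \<le> 1" for r
    proof -
      show "0 < \<psi> r" "\<psi> r \<le> 1 / \<epsilon>" "\<psi> r * E r \<le> 1"
        using pos[of r] E[of r] \<epsilon> by (auto simp: \<psi>_def field_simps)
      have "\<bar>\<psi>' r\<bar> = \<bar>c\<bar> * \<psi> r * (\<psi> r * E r)"
        using E[of r] pos[of r] by (simp add: \<psi>_def \<psi>'_def abs_mult power2_eq_square)
      also have "\<dots> \<le> \<bar>c\<bar> * \<psi> r * 1"
        using \<open>0 < \<psi> r\<close> \<open>\<psi> r * E r \<le> 1\<close> by (intro mult_left_mono) auto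
      finally show "\<bar>\<psi>' r\<bar> \<le> \<bar>c\<bar> * \<psi> r" by simp
    qed
    have E_deriv: "(E has_real_derivative - c * E r) (at r)" for r
      unfolding E_def[abs_def] by (auto intro!: derivative_eq_intros)
    have \<psi>_deriv: "(\<psi> has_real_derivative \<psi>' r) (at r)" for r
      unfolding \<psi>_def[abs_def] \<psi>'_def using pos[of r]
      by (auto intro!: derivative_eq_intros E_deriv simp: power2_eq_square)
    have E_cont: "continuous_on UNIV E" unfolding E_def[abs_def] by (intro continuous_intros)
    have pos': "\<epsilon> + E r \<noteq> 0" for r using pos[of r] by simp
    have cont: "continuous_on UNIV \<psi>" "continuous_on UNIV \<psi>'"
      unfolding \<psi>_def[abs_def] \<psi>'_def[abs_def] using pos' by (auto intro!: continuous_intros E_cont)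
    obtain N0 where N0: "\<And>r. norm (u r) \<le> N0" "0 \<le> N0" using bcontfunD[OF u(2)] by metis
    define v where "v r = \<psi> r *\<^sub>R u r" for r
    define f' where "f' r = \<psi> r *\<^sub>R f r + \<psi>' r *\<^sub>R u r" for r
    have v: "sol UNIV f' v"
      unfolding v_def f'_def by (rule sol_mult[OF u(1) cont(2)]) (rule \<psi>_deriv)
    define N where "N = (SUP r. norm (v r))"
    \<comment> \<open>This estimate degenerates as \<open>\<epsilon>\<close> tends to 0; it only
      ensures that \<open>N\<close> is a finite supremum, without which half of \<open>N\<close>
      could not be moved to the left below.\<close>
    have v_bd: "norm (v r) \<le> 1 / \<epsilon> * N0" for r
      unfolding v_def norm_scaleR using \<psi>[of r] N0 \<epsilon> by (intro mult_mono) auto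
    then have bdd: "bdd_above (range (\<lambda>r. norm (v r)))" by (auto intro!: bdd_aboveI)
    have N: "norm (v r) \<le> N" for r unfolding N_def by (rule cSUP_upper[OF UNIV_I bdd])
    have f'_bd: "norm (f' r) \<le> M + \<bar>c\<bar> * N" for r
    proof -
      have "norm (\<psi> r *\<^sub>R f r) \<le> \<psi> r * (M * E r)"
        unfolding norm_scaleR using \<psi>(1)[of r] M[of r] by (intro mult_mono) (auto simp: E_def)
      also have "\<dots> = M * (\<psi> r * E r)" by simp
      also have "\<dots> \<le> M" using mult_left_mono[OF \<psi>(4)[of r] M0] by simp
      finally have 1: "norm (\<psi> r *\<^sub>R f r) \<le> M" .
      have "norm (\<psi>' r *\<^sub>R u r) \<le> \<bar>c\<bar> * \<psi> r * norm (u r)"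
        unfolding norm_scaleR using \<psi>(3)[of r] by (intro mult_right_mono) auto
      also have "\<dots> = \<bar>c\<bar> * norm (v r)" using \<psi>(1)[of r] by (simp add: v_def)
      also have "\<dots> \<le> \<bar>c\<bar> * N" by (intro mult_left_mono N) auto
      finally show ?thesis unfolding f'_def using 1 norm_triangle_ineq[of "\<psi> r *\<^sub>R f r" "\<psi>' r *\<^sub>R u r"] by linarith
    qed
    have "v \<in> bcontfun" "f' \<in> bcontfun"
      using bcontfun_normI[OF solD(3)[OF v] v_bd] bcontfun_normI[OF solD(2)[OF v] f'_bd] by simp_all
    then have "norm (v r) \<le> K * (M + \<bar>c\<bar> * N)" for r using K(2)[OF v _ _ f'_bd] by simp
    then have "N \<le> K * (M + \<bar>c\<bar> * N)" unfolding N_def by (intro cSUP_least) auto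
    also have "\<dots> = K * M + (K * \<bar>c\<bar>) * N" by (simp add: algebra_simps)
    also have "\<dots> \<le> K * M + 1 / 2 * N"
      using order_trans[OF norm_ge_zero N] by (intro add_left_mono mult_right_mono c)
    finally have "N \<le> 2 * K * M" by simp
    then have "norm (v t) \<le> 2 * K * M" using N[of t] by simp
    moreover have "norm (u t) = (\<epsilon> + E t) * norm (v t)"
      using pos[of t] by (simp add: v_def \<psi>_def)
    ultimately show ?thesis using pos[of t] by (simp add: mult_left_mono)
  qed
  show ?thesis
  proof (rule field_le_epsilon)
    fix e :: real assume "e > 0"
    define \<epsilon> where "\<epsilon> = e / (2 * K * M + 1)"
    have "0 \<le> 2 * K * M" using K M0 by simp
    then have "\<epsilon> > 0" "\<epsilon> * (2 * K * M) \<le> e" using \<open>e > 0\<close> by (auto simp: \<epsilon>_def field_simps)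
    then show "norm (u t) \<le> 2 * K * M * exp (- c * (t - s)) + e"
      using *[of \<epsilon>] by (simp add: E_def algebra_simps)
  qed
qed


text \<open>\<open>u t x\<close> is the bounded response to the impulse \<open>x\<close> at time
  \<open>t\<close>, spread over \<open>[t, t + h]\<close> so that the forcing is continuous. Before
  \<open>t\<close> nothing has been received, so it solves the homogeneous equation; from
  \<open>t + h\<close> on the whole of \<open>x\<close> has been received. Uniqueness gives
  linearity in \<open>x\<close>.\<close>

lemma green_functions:
  obtains \<eta> L :: real and u :: "real \<Rightarrow> 'a \<Rightarrow> real \<Rightarrow> 'a" where "0 < \<eta>" "0 \<le> L"
    "\<And>t x. x \<in> X0 \<Longrightarrow> sol {..t} (\<lambda>_. 0) (u t x)"
    "\<And>t x r. x \<in> X0 \<Longrightarrow> t + h \<le> r \<Longrightarrow> u t x r = U r t (x + u t x t)"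
    "\<And>t x r. x \<in> X0 \<Longrightarrow> norm (u t x r) \<le> L * exp (- \<eta> * \<bar>r - t\<bar>) * norm x"
    "\<And>t x y r. x \<in> X0 \<Longrightarrow> y \<in> X0 \<Longrightarrow> u t (x + y) r = u t x r + u t y r"
    "\<And>t k x r. x \<in> X0 \<Longrightarrow> u t (k *\<^sub>R x) r = k *\<^sub>R u t x r"
    "\<And>x. x \<in> X0 \<Longrightarrow> continuous_on UNIV (\<lambda>t. u t x t)"
proof -
  obtain \<phi> a :: "real \<Rightarrow> real" and c where \<phi>: "continuous_on UNIV \<phi>" "\<And>r. r \<le> 0 \<Longrightarrow> \<phi> r = 0"
    "\<And>r. r \<ge> h \<Longrightarrow> \<phi> r = 0" "0 \<le> c" "\<And>r. \<bar>\<phi> r\<bar> \<le> c"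
    and a: "\<And>r. (a has_real_derivative \<phi> r) (at r)" "a 0 = 0" "\<And>r. r \<ge> h \<Longrightarrow> a r = 1"
    using bump_function[OF h] by metis
  obtain C where C: "0 \<le> C" "\<And>s t x. x \<in> X0 \<Longrightarrow> s \<le> t \<Longrightarrow> t \<le> s + h \<Longrightarrow> norm (U t s x) \<le> C * norm x"
    using U_bounded by metis
  obtain K where K: "0 < K" "\<And>f u M t. sol UNIV f u \<Longrightarrow> u \<in> bcontfun \<Longrightarrow> f \<in> bcontfun \<Longrightarrow>
    (\<And>t. norm (f t) \<le> M) \<Longrightarrow> norm (u t) \<le> K * M"
    using bounded_solution_bound by metis
  \<comment> \<open>The largest rate that \<open>weighted_solution_bound\<close> admits.\<close>
  define \<eta> where "\<eta> = 1 / (2 * K)"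
  have \<eta>: "0 < \<eta>" "K * \<eta> \<le> 1 / 2" using K(1) by (auto simp: \<eta>_def)
  \<comment> \<open>\<open>max r t\<close> keeps the arguments of \<open>U\<close> in their domain
    when \<open>r < t\<close>, where \<open>\<phi>\<close> vanishes anyway; this makes
    \<open>F\<close> jointly continuous on the plane.\<close>
  define F where "F t x r = \<phi> (r - t) *\<^sub>R U (max r t) t x" for t x r
  have F_cont2: "continuous_on UNIV (\<lambda>p. F (fst p) x (snd p))" if "x \<in> X0" for x
  proof -
    have "continuous_on UNIV (\<lambda>p::real\<times>real. U (max (snd p) (fst p)) (fst p) x)"
    proof -
      have "continuous_on UNIV (\<lambda>p::real\<times>real. (max (snd p) (fst p), fst p))"
        by (intro continuous_intros)
      moreover have "range (\<lambda>p::real\<times>real. (max (snd p) (fst p), fst p)) \<subseteq> {(t, s). t \<ge> s}"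
        by auto
      ultimately have "continuous_on UNIV (\<lambda>p::real\<times>real. case (max (snd p) (fst p), fst p) of (t, s) \<Rightarrow> U t s x)"
        by (rule continuous_on_compose2[OF U_cont[OF that]])
      then show ?thesis by simp
    qed
    moreover have "continuous_on UNIV (\<lambda>p::real\<times>real. \<phi> (snd p - fst p))"
      by (rule continuous_on_compose2[OF \<phi>(1)]) (auto intro!: continuous_intros)
    ultimately show ?thesis unfolding F_def by (rule continuous_on_scaleR[rotated])
  qed
  have F_cont: "continuous_on UNIV (F t x)" if "x \<in> X0" for t x
  proof -
    have "continuous_on UNIV (\<lambda>r::real. (t, r))" by (intro continuous_intros)
    from continuous_on_compose2[OF F_cont2[OF that] this] show ?thesis by simp
  qed
  have F_0: "F t x r = 0" if "r \<le> t \<or> r \<ge> t + h" for t x r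
    using \<phi>(2)[of "r - t"] \<phi>(3)[of "r - t"] that by (auto simp: F_def)
  \<comment> \<open>The impulse lives on \<open>[t, t + h]\<close>, where every weight of rate at
    most \<open>\<eta>\<close> in modulus is at least \<open>exp (- \<eta> * h)\<close>. The factor
    \<open>exp (\<eta> * h)\<close> thus serves both signs of \<open>d\<close>.\<close>
  have F_bd: "norm (F t x r) \<le> (c * C * exp (\<eta> * h) * norm x) * exp (- d * (r - t))"
    if x: "x \<in> X0" and d: "\<bar>d\<bar> \<le> \<eta>" for t x r d
  proof (cases "t \<le> r \<and> r \<le> t + h")
    case True
    have "norm (F t x r) \<le> c * (C * norm x)"
      unfolding F_def norm_scaleR using True C(2)[OF x, of t r] \<phi>(4,5) by (intro mult_mono) (auto simp: max_def)
    also have "\<dots> \<le> c * (C * norm x) * exp (\<eta> * h + - d * (r - t))"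
    proof -
      have "d * (r - t) \<le> \<eta> * h"
        using mult_mono[of d \<eta> "r - t" h] True d \<eta> by auto
      then have "1 \<le> exp (\<eta> * h + - d * (r - t))" by simp
      then show ?thesis using mult_left_mono[of 1 _ "c * (C * norm x)"] \<phi>(4) C(1) by simp
    qed
    also have "\<dots> = (c * C * exp (\<eta> * h) * norm x) * exp (- d * (r - t))"
      by (simp only: exp_add mult_ac)
    finally show ?thesis .
  next
    case False
    then show ?thesis using F_0[of r t x] \<phi>(4) C(1) by auto
  qed
  have F_bcont: "F t x \<in> bcontfun" if "x \<in> X0" for t x
    by (rule bcontfun_normI[OF F_cont[OF that]]) (use F_bd[OF that, of 0 t] \<eta>(1) in simp)
  have "\<forall>t x. \<exists>u. x \<in> X0 \<longrightarrow> u \<in> bcontfun \<and> sol UNIV (F t x) u"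
    using admissible[OF F_bcont] by metis
  then obtain u where u: "\<And>t x. x \<in> X0 \<Longrightarrow> u t x \<in> bcontfun" "\<And>t x. x \<in> X0 \<Longrightarrow> sol UNIV (F t x) (u t x)"
    by metis
  define L where "L = 2 * K * (c * C * exp (\<eta> * h))"
  have uX: "u t x r \<in> X0" if "x \<in> X0" for t x r using solD(4)[OF u(2)[OF that]] by simp
  show thesis
  proof (rule that[of \<eta> L u])
    show "0 < \<eta>" by fact
    show "0 \<le> L" using K(1) \<phi>(4) C(1) by (simp add: L_def)
    show "sol {..t} (\<lambda>_. 0) (u t x)" if "x \<in> X0" for t x
      by (rule sol_cong[OF sol_subset[OF u(2)[OF that] is_interval_ic]]) (auto simp: F_0)
    show "u t x r = U r t (x + u t x t)" if x: "x \<in> X0" and r: "t + h \<le> r" for t x r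
    proof -
      \<comment> \<open>Switching the orbit of \<open>x\<close> on by \<open>a\<close> solves the
        equation with forcing \<open>F t x\<close> and initial value 0. Adding the orbit of
        \<open>u t x t\<close> matches \<open>u t x\<close> at time \<open>t\<close>, and
        \<open>a\<close> equals 1 from \<open>t + h\<close> on.\<close>
      have "sol {t..} (\<lambda>r. a (r - t) *\<^sub>R 0 + \<phi> (r - t) *\<^sub>R U r t x) (\<lambda>r. a (r - t) *\<^sub>R U r t x)"
      proof (rule sol_mult[OF U_sol[OF x]])
        show "continuous_on {t..} (\<lambda>r. \<phi> (r - t))"
          by (rule continuous_on_compose2[OF \<phi>(1)]) (auto intro!: continuous_intros)
        show "((\<lambda>r. a (r - t)) has_real_derivative \<phi> (r - t)) (at r within {t..})" for r
          using DERIV_shift[of a "\<phi> (r - t)" r "- t"] a(1)[of "r - t"]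
          by (simp add: has_field_derivative_at_within)
      qed
      from sol_add[OF U_sol[OF uX[OF x]] this]
      have v: "sol {t..} (F t x) (\<lambda>r. U r t (u t x t) + a (r - t) *\<^sub>R U r t x)"
        by (rule sol_cong) (auto simp: F_def max_def)
      have u': "sol {t..} (F t x) (u t x)"
        by (rule sol_subset[OF u(2)[OF x] is_interval_ci subset_UNIV])
      have "u t x r = U r t (u t x t) + a (r - t) *\<^sub>R U r t x"
        by (rule sol_unique_forward[OF u' v, of t r]) (use r h uX[OF x] in \<open>auto simp: U_refl a(2)\<close>)
      then show ?thesis using r h x uX[OF x] by (simp add: a U_add add.commute)
    qed
    show "norm (u t x r) \<le> L * exp (- \<eta> * \<bar>r - t\<bar>) * norm x" if x: "x \<in> X0" for t x r
    proof -
      \<comment> \<open>The two signs of \<open>d\<close> give decay to the right and to the left of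
        \<open>t\<close>; together they yield the absolute value in the exponent.\<close>
      have *: "norm (u t x r) \<le> L * exp (- d * (r - t)) * norm x" if "\<bar>d\<bar> = \<eta>" for d
      proof -
        have "norm (u t x r) \<le> 2 * K * (c * C * exp (\<eta> * h) * norm x) * exp (- d * (r - t))"
        proof (rule weighted_solution_bound[OF K(1)])
          fix f v :: "real \<Rightarrow> 'a" and M s
          assume "sol UNIV f v" "v \<in> bcontfun" "f \<in> bcontfun" "\<And>t. norm (f t) \<le> M"
          then show "norm (v s) \<le> K * M" by (rule K(2))
        next
          show "K * \<bar>d\<bar> \<le> 1 / 2" using that \<eta>(2) by simp
          show "sol UNIV (F t x) (u t x)" "u t x \<in> bcontfun" by (intro u x)+
          show "norm (F t x r) \<le> (c * C * exp (\<eta> * h) * norm x) * exp (- d * (r - t))" for r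
            using that by (intro F_bd x) simp
        qed
        then show ?thesis by (simp add: L_def mult_ac)
      qed
      show ?thesis
        using *[of \<eta>] *[of "- \<eta>"] \<eta>(1) by (cases "t \<le> r") (auto simp: abs_if algebra_simps)
    qed
    show "u t (x + y) r = u t x r + u t y r" if "x \<in> X0" "y \<in> X0" for t x y r
    proof -
      have "F t (x + y) r = F t x r + F t y r" for r
        unfolding F_def using that by (simp add: U_add scaleR_add_right)
      then have s: "sol UNIV (F t (x + y)) (\<lambda>r. u t x r + u t y r)"
        by (intro sol_cong[OF sol_add[OF u(2) u(2), OF that]]) auto
      have "u t (x + y) = (\<lambda>r. u t x r + u t y r)"
        by (rule bounded_solution_unique[OF u(1) u(2) plus_cont[OF u(1) u(1)] s F_bcont]) (use that X0_closed_ops in auto)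
      then show ?thesis by simp
    qed
    show "u t (k *\<^sub>R x) r = k *\<^sub>R u t x r" if "x \<in> X0" for t k x r
    proof -
      have "F t (k *\<^sub>R x) r = k *\<^sub>R F t x r" for r
        unfolding F_def using that by (simp add: U_scaleR)
      then have s: "sol UNIV (F t (k *\<^sub>R x)) (\<lambda>r. k *\<^sub>R u t x r)"
        by (intro sol_cong[OF sol_scaleR[OF u(2)[OF that]]]) auto
      have "u t (k *\<^sub>R x) = (\<lambda>r. k *\<^sub>R u t x r)"
        by (rule bounded_solution_unique[OF u(1) u(2) scaleR_cont[OF u(1)] s F_bcont]) (use that X0_closed_ops in auto)
      then show ?thesis by simp
    qed
    show "continuous_on UNIV (\<lambda>t. u t x t)" if x: "x \<in> X0" for x
      unfolding continuous_on_iff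
    proof (intro ballI allI impI)
      fix s e :: real assume e: "e > 0"
      define e' where "e' = e / (4 * K)"
      have e': "e' > 0" "K * e' < e / 2" using e K(1) by (auto simp: e'_def)
      \<comment> \<open>For \<open>t\<close> within distance 1 of \<open>s\<close>, the supports of
        \<open>F t x\<close> and \<open>F s x\<close> lie in \<open>{s - 1..s + 1 + h}\<close>.
        Uniform continuity on the compact set \<open>Q\<close> therefore controls their difference
        on the whole line.\<close>
      define Q where "Q = {s - 1..s + 1} \<times> {s - 1..s + 1 + h}"
      have "uniformly_continuous_on Q (\<lambda>p. F (fst p) x (snd p))"
        unfolding Q_def by (intro compact_uniformly_continuous continuous_on_subset[OF F_cont2[OF x]] compact_Times) auto
      then obtain d1 where d1: "d1 > 0" "\<And>p p'. p \<in> Q \<Longrightarrow> p' \<in> Q \<Longrightarrow> dist p' p < d1 \<Longrightarrow>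
          dist (F (fst p') x (snd p')) (F (fst p) x (snd p)) < e'"
        using e'(1) unfolding uniformly_continuous_on_def by meson
      obtain d2 where d2: "d2 > 0" "\<And>t. dist t s < d2 \<Longrightarrow> dist (u s x t) (u s x s) < e / 2"
        using solD(3)[OF u(2)[OF x, of s]] e unfolding continuous_on_iff by (meson UNIV_I half_gt_zero)
      show "\<exists>d>0. \<forall>t\<in>UNIV. dist t s < d \<longrightarrow> dist (u t x t) (u s x s) < e"
      proof (intro exI[of _ "min 1 (min d1 d2)"] conjI ballI impI)
        fix t assume t: "dist t s < min 1 (min d1 d2)"
        have F_diff: "norm (F t x r - F s x r) \<le> e'" for r
        proof (cases "r \<in> {s - 1..s + 1 + h}")
          case True
          then have "(t, r) \<in> Q" "(s, r) \<in> Q" "dist (t, r) (s, r) < d1"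
            using t h by (auto simp: Q_def dist_Pair_Pair dist_real_def)
          then show ?thesis using d1(2)[of "(s, r)" "(t, r)"] by (simp add: dist_norm)
        next
          case False
          then have "F t x r = 0" "F s x r = 0" using t by (auto intro!: F_0 simp: dist_real_def)
          then show ?thesis using e' by simp
        qed
        have "norm (u t x t - u s x t) \<le> K * e'"
          by (rule K(2)[OF sol_diff[OF u(2)[OF x] u(2)[OF x]] minus_cont[OF u(1)[OF x] u(1)[OF x]]
                minus_cont[OF F_bcont[OF x] F_bcont[OF x]] F_diff])
        then have "dist (u t x t) (u s x t) < e / 2" using e'(2) by (simp add: dist_norm)
        moreover have "dist (u s x t) (u s x s) < e / 2" using t by (intro d2) simp
        ultimately show "dist (u t x t) (u s x s) < e" using dist_triangle[of "u t x t" "u s x s" "u s x t"] by linarith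
      qed (use d1(1) d2(1) in auto)
    qed
  qed
qed

subsection \<open>Admissibility implies dichotomy\<close>

definition stable :: "real \<Rightarrow> 'a \<Rightarrow> bool" where
  "stable t y \<longleftrightarrow> y \<in> X0 \<and> (\<exists>c. \<forall>r\<ge>t. norm (U r t y) \<le> c)"

text \<open>\<open>U\<close> need not be invertible, so a bounded history of \<open>y\<close> is
  asserted to exist rather than computed from \<open>y\<close>. The stable and unstable vectors will
  be the ranges of the projections.\<close>

definition unstable :: "real \<Rightarrow> 'a \<Rightarrow> bool" where
  "unstable t y \<longleftrightarrow> (\<exists>v. sol {..t} (\<lambda>_. 0) v \<and> v t = y \<and> (\<exists>c. \<forall>r\<le>t. norm (v r) \<le> c))"

lemma U_bounded_on_interval:
  assumes "x \<in> X0"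
  obtains c where "\<And>r. r \<in> {s..t} \<Longrightarrow> norm (U r s x) \<le> c"
proof -
  have "continuous_on {s..t} (\<lambda>r. U r s x)"
    by (rule continuous_on_subset[OF U_cont_left[OF assms]]) auto
  then have "bounded ((\<lambda>r. U r s x) ` {s..t})"
    by (intro compact_imp_bounded compact_continuous_image) auto
  then show thesis using that unfolding bounded_iff by blast
qed

lemma unstable_mem: "unstable t y \<Longrightarrow> y \<in> X0"
  using solD(4) by (fastforce simp: unstable_def)

text \<open>A bounded history and a bounded future of the same vector glue to a bounded homogeneous
  solution on the line, which the uniqueness half of admissibility forces to vanish.\<close>

lemma stable_unstable_0:
  assumes "stable t y" "unstable t y"
  shows "y = 0"
proof -
  obtain c where y: "y \<in> X0" "\<And>r. r \<ge> t \<Longrightarrow> norm (U r t y) \<le> c"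
    using assms(1) by (auto simp: stable_def)
  obtain v c' where v: "sol {..t} (\<lambda>_. 0) v" "v t = y" "\<And>r. r \<le> t \<Longrightarrow> norm (v r) \<le> c'"
    using assms(2) by (auto simp: unstable_def)
  define w where "w r = (if r \<le> t then v r else U r t y)" for r
  have w: "sol UNIV (\<lambda>_. 0) w"
  proof (rule sol_glue[where P = "{..t}" and Q = "{t..}" and b = t])
    show "sol {..t} (\<lambda>_. 0) w" by (rule sol_cong[OF v(1)]) (auto simp: w_def)
    show "sol {t..} (\<lambda>_. 0) w" by (rule sol_cong[OF U_sol[OF y(1)]]) (auto simp: w_def v(2) U_refl y(1))
  qed (auto simp: is_interval_univ)
  have "norm (w r) \<le> max c c'" for r
    using y(2)[of r] v(3)[of r] by (auto simp: w_def max_def)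
  then have "w t = 0" by (rule bounded_homogeneous_solution_0[OF w])
  then show ?thesis by (simp add: w_def v(2))
qed

lemma stable_diff:
  assumes "stable t y" "stable t z"
  shows "stable t (y - z)"
proof -
  obtain c c' where yz: "y \<in> X0" "z \<in> X0" "\<And>r. r \<ge> t \<Longrightarrow> norm (U r t y) \<le> c"
    "\<And>r. r \<ge> t \<Longrightarrow> norm (U r t z) \<le> c'"
    using assms by (auto simp: stable_def)
  have "norm (U r t (y - z)) \<le> c + c'" if "r \<ge> t" for r
    using norm_triangle_ineq4[of "U r t y" "U r t z"] yz(3,4)[OF that] U_diff[OF that yz(1,2)] by simp
  then show ?thesis using X0_closed_ops(3)[OF yz(1,2)] by (auto simp: stable_def)
qed

lemma unstable_diff:
  assumes "unstable t y" "unstable t z"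
  shows "unstable t (y - z)"
proof -
  obtain v c where v: "sol {..t} (\<lambda>_. 0) v" "v t = y" "\<And>r. r \<le> t \<Longrightarrow> norm (v r) \<le> c"
    using assms(1) by (auto simp: unstable_def)
  obtain w c' where w: "sol {..t} (\<lambda>_. 0) w" "w t = z" "\<And>r. r \<le> t \<Longrightarrow> norm (w r) \<le> c'"
    using assms(2) by (auto simp: unstable_def)
  have "norm (v r - w r) \<le> c + c'" if "r \<le> t" for r
    using norm_triangle_ineq4[of "v r" "w r"] v(3)[OF that] w(3)[OF that] by linarith
  then show ?thesis using sol_diff[OF v(1) w(1)] v(2) w(2)
    unfolding unstable_def by (intro exI[of _ "\<lambda>r. v r - w r"]) auto
qed

lemma stable_U:
  assumes "stable s y" "s \<le> t"
  shows "stable t (U t s y)"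
  using assms U_mem unfolding stable_def by (metis U_trans order_trans)

lemma unstable_U:
  assumes y: "unstable s y" and st: "s \<le> t"
  shows "unstable t (U t s y)"
proof -
  obtain v c where v: "sol {..s} (\<lambda>_. 0) v" "v s = y" "\<And>r. r \<le> s \<Longrightarrow> norm (v r) \<le> c"
    using y by (auto simp: unstable_def)
  have X: "y \<in> X0" using unstable_mem[OF y] .
  obtain c' where c': "\<And>r. r \<in> {s..t} \<Longrightarrow> norm (U r s y) \<le> c'"
    using U_bounded_on_interval[OF X] by blast
  define w where "w r = (if r \<le> s then v r else U r s y)" for r
  have "sol {..t} (\<lambda>_. 0) w"
  proof (rule sol_glue[where P = "{..s}" and Q = "{s..t}" and b = s])
    show "sol {..s} (\<lambda>_. 0) w" by (rule sol_cong[OF v(1)]) (auto simp: w_def)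
    have "sol {s..t} (\<lambda>_. 0) (\<lambda>r. U r s y)"
      by (rule sol_subset[OF U_sol[OF X] is_interval_cc]) auto
    then show "sol {s..t} (\<lambda>_. 0) w" by (rule sol_cong) (auto simp: w_def v(2) U_refl X)
  qed (use st in \<open>auto simp: is_interval_ic\<close>)
  moreover have "w t = U t s y" using st by (auto simp: w_def v(2) U_refl X)
  moreover have "norm (w r) \<le> max c c'" if "r \<le> t" for r
    using v(3)[of r] c'[of r] that by (auto simp: w_def max_def)
  ultimately show ?thesis unfolding unstable_def by blast
qed

text \<open>A vector that is mapped to 0 in finite time has a bounded future and is therefore stable
  as well. This is the injectivity of \<open>U\<close> on unstable vectors.\<close>

lemma unstable_U_eq_0:
  assumes z: "unstable s z" and st: "s \<le> t" and 0: "U t s z = 0"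
  shows "z = 0"
proof (rule stable_unstable_0[OF _ z])
  have X: "z \<in> X0" using unstable_mem[OF z] .
  obtain c where c: "\<And>r. r \<in> {s..t} \<Longrightarrow> norm (U r s z) \<le> c"
    using U_bounded_on_interval[OF X] by blast
  have "norm (U r s z) \<le> max c 0" if "r \<ge> s" for r
  proof (cases "r \<le> t")
    case False
    then have "U r s z = U r t (U t s z)" using st X by (simp add: U_trans)
    then show ?thesis using 0 False U_0[of t r] by simp
  qed (use c[of r] that in auto)
  then show "stable s z" using X by (auto simp: stable_def)
qed

lemma admissible_imp_dichotomy: "has_exponential_dichotomy X0 U"
proof -
  obtain \<eta> L :: real and u :: "real \<Rightarrow> 'a \<Rightarrow> real \<Rightarrow> 'a" where \<eta>: "0 < \<eta>" and L: "0 \<le> L"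
    and u_sol: "\<And>t x. x \<in> X0 \<Longrightarrow> sol {..t} (\<lambda>_. 0) (u t x)"
    and u_fwd: "\<And>t x r. x \<in> X0 \<Longrightarrow> t + h \<le> r \<Longrightarrow> u t x r = U r t (x + u t x t)"
    and u_bd: "\<And>t x r. x \<in> X0 \<Longrightarrow> norm (u t x r) \<le> L * exp (- \<eta> * \<bar>r - t\<bar>) * norm x"
    and u_add: "\<And>t x y r. x \<in> X0 \<Longrightarrow> y \<in> X0 \<Longrightarrow> u t (x + y) r = u t x r + u t y r"
    and u_scaleR: "\<And>t k x r. x \<in> X0 \<Longrightarrow> u t (k *\<^sub>R x) r = k *\<^sub>R u t x r"
    and u_cont: "\<And>x. x \<in> X0 \<Longrightarrow> continuous_on UNIV (\<lambda>t. u t x t)"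
    by (rule green_functions) (rule that)
  obtain C where C: "0 \<le> C" "\<And>s t x. x \<in> X0 \<Longrightarrow> s \<le> t \<Longrightarrow> t \<le> s + h \<Longrightarrow> norm (U t s x) \<le> C * norm x"
    using U_bounded by metis
  define Pp Pm where "Pp t x = x + u t x t" and "Pm t x = - u t x t" for t x
  have PpPm: "Pp t x + Pm t x = x" for t x by (simp add: Pp_def Pm_def)
  have uX: "u t x r \<in> X0" if "x \<in> X0" "r \<le> t" for t x r
    using solD(4)[OF u_sol[OF that(1)]] that(2) by simp
  have PX: "Pp t x \<in> X0" "Pm t x \<in> X0" if "x \<in> X0" for t x
    using uX[OF that, of t t] that X0_closed_ops by (auto simp: Pp_def Pm_def)
  have u_bd0: "norm (u t x r) \<le> L * norm x" if "x \<in> X0" for t x r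
  proof -
    have "L * exp (- \<eta> * \<bar>r - t\<bar>) * norm x \<le> L * 1 * norm x"
      using L \<eta> by (intro mult_right_mono mult_left_mono) auto
    then show ?thesis using u_bd[OF that, of t r] by simp
  qed
  have Pp_bd: "norm (Pp t x) \<le> (1 + L) * norm x" if "x \<in> X0" for t x
    using norm_triangle_ineq[of x "u t x t"] u_bd0[OF that, of t t] by (simp add: Pp_def distrib_right)
  have unst: "unstable t (Pm t x)" if "x \<in> X0" for t x
    unfolding unstable_def
  proof (intro exI[of _ "\<lambda>r. - u t x r"] conjI)
    show "sol {..t} (\<lambda>_. 0) (\<lambda>r. - u t x r)" using sol_scaleR[OF u_sol[OF that], of t "-1"] by simp
    show "\<exists>c. \<forall>r\<le>t. norm (- u t x r) \<le> c" using u_bd0[OF that] by auto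
  qed (simp add: Pm_def)
  have st: "stable t (Pp t x)" if x: "x \<in> X0" for t x
  proof -
    have "norm (U r t (Pp t x)) \<le> max (C * norm (Pp t x)) (L * norm x)" if r: "r \<ge> t" for r
    proof (cases "r \<le> t + h")
      case True
      show ?thesis by (rule max.coboundedI1[OF C(2)[OF PX(1)[OF x] r True]])
    next
      case False
      then have "U r t (Pp t x) = u t x r" using u_fwd[OF x, of t r] by (simp add: Pp_def)
      then show ?thesis using u_bd0[OF x, of t r] by simp
    qed
    then show ?thesis using PX x by (auto simp: stable_def)
  qed
  \<comment> \<open>The defect \<open>y - Pp t y\<close> equals \<open>Pm t y\<close>, so it is
    stable as a difference and unstable by construction. Idempotence of both projections rests on
    this and on the mirror image below.\<close>
  have st_fix: "Pm t y = 0" "Pp t y = y" if "stable t y" for t y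
  proof -
    have y: "y \<in> X0" using that by (simp add: stable_def)
    have "stable t (y - Pp t y)" by (rule stable_diff[OF that st[OF y]])
    moreover have "y - Pp t y = Pm t y" by (simp add: Pp_def Pm_def)
    ultimately show "Pm t y = 0" using stable_unstable_0 unst[OF y] by simp
    then show "Pp t y = y" using PpPm[of t y] by simp
  qed
  have un_fix: "Pp t z = 0" "Pm t z = z" if "unstable t z" for t z
  proof -
    have z: "z \<in> X0" using that by (rule unstable_mem)
    have "unstable t (z - Pm t z)" by (rule unstable_diff[OF that unst[OF z]])
    moreover have "z - Pm t z = Pp t z" by (simp add: Pp_def Pm_def)
    ultimately show "Pp t z = 0" using stable_unstable_0[OF st[OF z]] by simp
    then show "Pm t z = z" using PpPm[of t z] by simp
  qed
  have lin: "linear_operator_on X0 (Pp t)" "linear_operator_on X0 (Pm t)" for t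
    using X0(1) by (auto simp: linear_operator_on_def Pp_def Pm_def u_add u_scaleR algebra_simps)
  \<comment> \<open>\<open>U\<close> preserves both kinds of vectors, hence it maps the
    decomposition of \<open>x\<close> at time \<open>s\<close> to the decomposition of
    \<open>U t s x\<close> at time \<open>t\<close>.\<close>
  have comm: "Pp t (U t s x) = U t s (Pp s x)" if le: "s \<le> t" and x: "x \<in> X0" for s t x
  proof -
    have "U t s x = U t s (Pp s x) + U t s (Pm s x)"
      using U_add[OF le PX(1)[OF x, of s] PX(2)[OF x, of s]] PpPm[of s x] by simp
    then have "Pp t (U t s x) = Pp t (U t s (Pp s x)) + Pp t (U t s (Pm s x))"
      using lin(1)[of t] U_mem[OF le PX(1)[OF x]] U_mem[OF le PX(2)[OF x]] by (simp add: linear_operator_on_def)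
    also have "\<dots> = U t s (Pp s x)"
      using st_fix(2)[OF stable_U[OF st[OF x] le]] un_fix(1)[OF unstable_U[OF unst[OF x] le]] by simp
    finally show ?thesis .
  qed
  \<comment> \<open>The history of \<open>Pm t x\<close> is explicit: its value at \<open>s\<close>
    is \<open>- u t x s\<close>. This gives surjectivity onto the unstable range and identifies the
    inverse, whose decay is that of \<open>u\<close>.\<close>
  have u_back: "unstable s (- u t x s)" "U t s (- u t x s) = Pm t x" if le: "s \<le> t" and x: "x \<in> X0" for s t x
  proof -
    have v: "sol {..t} (\<lambda>_. 0) (\<lambda>r. - u t x r)" using sol_scaleR[OF u_sol[OF x], of t "-1"] by simp
    have "sol {..s} (\<lambda>_. 0) (\<lambda>r. - u t x r)"
      by (rule sol_subset[OF v is_interval_ic]) (use le in auto)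
    then show "unstable s (- u t x s)"
      using u_bd0[OF x, of t] unfolding unstable_def by (intro exI[of _ "\<lambda>r. - u t x r"]) auto
    show "U t s (- u t x s) = Pm t x"
      using sol_homogeneous_eq[OF v, of s t] le by (simp add: Pm_def)
  qed
  have inj: "inj_on (U t s) (Pm s ` X0)" if le: "s \<le> t" for s t
  proof (rule inj_onI)
    fix y z assume yz: "y \<in> Pm s ` X0" "z \<in> Pm s ` X0" "U t s y = U t s z"
    then have "unstable s y" "unstable s z" "y \<in> X0" "z \<in> X0" using unst PX by auto
    then have "unstable s (y - z)" "U t s (y - z) = 0" using unstable_diff yz(3) U_diff[OF le] by auto
    then have "y - z = 0" by (rule unstable_U_eq_0[OF _ le])
    then show "y = z" by simp
  qed
  have bij: "bij_betw (U t s) (Pm s ` X0) (Pm t ` X0)" if le: "s \<le> t" for s t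
    unfolding bij_betw_def
  proof (intro conjI inj[OF le] equalityI subsetI)
    fix y assume "y \<in> U t s ` Pm s ` X0"
    then obtain x where "x \<in> X0" "y = U t s (Pm s x)" by auto
    then have "unstable t y" using unstable_U[OF unst le] by simp
    then show "y \<in> Pm t ` X0" using un_fix(2)[of t y] unstable_mem[of t y] by (metis imageI)
  next
    fix y assume "y \<in> Pm t ` X0"
    then obtain x where x: "x \<in> X0" "y = Pm t x" by auto
    have "- u t x s = Pm s (- u t x s)" using un_fix(2)[OF u_back(1)[OF le x(1)]] by simp
    then have "- u t x s \<in> Pm s ` X0" using unstable_mem[OF u_back(1)[OF le x(1)]] by (metis imageI)
    then show "y \<in> U t s ` Pm s ` X0" using u_back(2)[OF le x(1)] x(2) by (metis imageI)
  qed
  \<comment> \<open>\<open>L\<close> serves wherever an operator is expressed by \<open>u\<close>.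
    The third entry covers \<open>t \<le> s + h\<close>, where the orbit of \<open>Pp s x\<close>
    need not yet coincide with \<open>u s x\<close> and only the local bound \<open>C\<close> is
    available; the entry 1 is demanded of a dichotomy constant.\<close>
  define \<kappa> where "\<kappa> = Max {1, L, C * (1 + L) * exp (\<eta> * h)}"
  have \<kappa>: "1 \<le> \<kappa>" "L \<le> \<kappa>" "C * (1 + L) * exp (\<eta> * h) \<le> \<kappa>" by (auto simp: \<kappa>_def)
  have L_bd: "norm (u t x r) \<le> \<kappa> * exp (- \<eta> * \<bar>r - t\<bar>) * norm x" if "x \<in> X0" for t x r
    using u_bd[OF that, of t r] \<kappa>(2)
    by (elim order_trans) (intro mult_right_mono, auto)
  have Pp_opnorm: "opnorm_le X0 (U t s \<circ> Pp s) (\<kappa> * exp (- \<eta> * (t - s)))" if le: "s \<le> t" for s t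
    unfolding opnorm_le_def
  proof
    fix x assume x: "x \<in> X0"
    show "norm ((U t s \<circ> Pp s) x) \<le> \<kappa> * exp (- \<eta> * (t - s)) * norm x"
    proof (cases "t \<le> s + h")
      case True
      have "norm (U t s (Pp s x)) \<le> C * norm (Pp s x)" using C(2)[OF PX(1)[OF x] le True] .
      also have "\<dots> \<le> C * ((1 + L) * norm x)" using C(1) Pp_bd[OF x] by (rule mult_left_mono[rotated])
      also have "\<dots> = C * (1 + L) * norm x * 1" by simp
      also have "\<dots> \<le> C * (1 + L) * norm x * exp (\<eta> * h + - \<eta> * (t - s))"
      proof (rule mult_left_mono)
        have "\<eta> * (t - s) \<le> \<eta> * h" using True \<eta> by (intro mult_left_mono) auto
        then show "1 \<le> exp (\<eta> * h + - \<eta> * (t - s))" by simp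
      qed (use C(1) L in simp)
      also have "\<dots> = C * (1 + L) * exp (\<eta> * h) * (exp (- \<eta> * (t - s)) * norm x)"
        by (simp only: exp_add mult_ac)
      also have "\<dots> \<le> \<kappa> * (exp (- \<eta> * (t - s)) * norm x)" by (intro mult_right_mono \<kappa>) auto
      finally show ?thesis by (simp add: mult_ac)
    next
      case False
      then show ?thesis using u_fwd[OF x, of s t] L_bd[OF x, of s t] le by (simp add: Pp_def)
    qed
  qed
  have Pm_opnorm: "opnorm_le X0 (inv_into (Pm s ` X0) (U t s) \<circ> Pm t) (\<kappa> * exp (- \<eta> * (t - s)))"
    if le: "s \<le> t" for s t
    unfolding opnorm_le_def
  proof
    fix x assume x: "x \<in> X0"
    have "- u t x s = Pm s (- u t x s)" using un_fix(2)[OF u_back(1)[OF le x]] by simp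
    then have "- u t x s \<in> Pm s ` X0" using unstable_mem[OF u_back(1)[OF le x]] by (metis imageI)
    then have "inv_into (Pm s ` X0) (U t s) (Pm t x) = - u t x s"
      by (rule inv_into_f_eq[OF inj[OF le] _ u_back(2)[OF le x]])
    then show "norm ((inv_into (Pm s ` X0) (U t s) \<circ> Pm t) x) \<le> \<kappa> * exp (- \<eta> * (t - s)) * norm x"
      using L_bd[OF x, of t s] le by simp
  qed
  have proj: "bounded_projection X0 (Pp t)" "bounded_projection X0 (Pm t)" for t
  proof -
    have "opnorm_le X0 (Pp t) (1 + L)" "opnorm_le X0 (Pm t) L"
      using Pp_bd u_bd0 by (auto simp: opnorm_le_def Pm_def)
    then show "bounded_projection X0 (Pp t)" "bounded_projection X0 (Pm t)"
      using lin[of t] PX st_fix(2)[OF st] un_fix(2)[OF unst]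
      unfolding bounded_projection_def bounded_operators_def by blast+
  qed
  have "exponential_dichotomy_with X0 U \<kappa> \<eta>"
    unfolding exponential_dichotomy_with_def
  proof (rule exI[of _ Pp], rule exI[of _ Pm], intro conjI allI ballI impI)
    fix x assume x: "x \<in> X0"
    show "continuous_on UNIV (\<lambda>t. Pp t x)" "continuous_on UNIV (\<lambda>t. Pm t x)"
      unfolding Pp_def Pm_def by (intro continuous_intros u_cont x)+
  qed (use proj PpPm comm bij Pp_opnorm Pm_opnorm in simp_all)
  then show ?thesis unfolding has_exponential_dichotomy_def using \<kappa>(1) \<eta> by blast
qed

end

section \<open>From the hypotheses on \<open>A\<close>, \<open>B\<close> and \<open>U_B\<close> to
  the abstract setting\<close>

lemma subspace_closure:
  fixes S :: "'a::real_normed_vector set"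
  assumes S: "subspace S"
  shows "subspace (closure S)"
  unfolding subspace_def
proof (intro conjI ballI allI)
  show "0 \<in> closure S" using subspace_0[OF S] closure_subset by blast
next
  fix x y assume "x \<in> closure S" "y \<in> closure S"
  then obtain f g where "\<And>n. f n \<in> S" "f \<longlonglongrightarrow> x" "\<And>n. g n \<in> S" "g \<longlonglongrightarrow> y"
    unfolding closure_sequential by blast
  then show "x + y \<in> closure S"
    unfolding closure_sequential
    by (intro exI[of _ "\<lambda>n. f n + g n"] conjI allI tendsto_add subspace_add[OF S])
next
  fix c x assume "x \<in> closure S"
  then obtain f where "\<And>n. f n \<in> S" "f \<longlonglongrightarrow> x"
    unfolding closure_sequential by blast
  then show "c *\<^sub>R x \<in> closure S"
    unfolding closure_sequential
    by (intro exI[of _ "\<lambda>n. c *\<^sub>R f n"] conjI allI tendsto_scaleR tendsto_const subspace_scale[OF S])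
qed

theorem theorem1p10:
  fixes D :: "'a::banach set" and A :: "'a \<Rightarrow> 'a"
    and B :: "real \<Rightarrow> 'a \<Rightarrow> 'a" and b :: "real \<Rightarrow> real"
    and U_B :: "real \<Rightarrow> real \<Rightarrow> 'a \<Rightarrow> 'a"
  assumes "linear_operator_on D A"
    and "resolvent_condition D A"
    and "forcing_condition D A"
    and "perturbation_condition (closure D) B b"
    and "bdd_above (range b)"
    and "is_evolution_family_of D A B U_B"
  shows "has_exponential_dichotomy (closure D) U_B \<longleftrightarrow>
    (\<forall>f \<in> (bcontfun :: (real \<Rightarrow> 'a) set). \<exists>!u. u \<in> bcontfun \<and> integrated_solution D A B f u)"
proof -
  have A: "subspace D" "\<And>c x. x \<in> D \<Longrightarrow> A (c *\<^sub>R x) = c *\<^sub>R A x"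
    using assms(1) by (auto simp: linear_operator_on_def)
  have A0: "A 0 = 0" using A(2)[of 0 0] subspace_0[OF A(1)] by simp

  obtain w where "{w<..} \<subseteq> resolvent_set D A"
    using assms(2) by (auto simp: resolvent_condition_def)
  then have "w + 1 \<in> resolvent_set D A" by auto
  then obtain l where l: "bij_betw (\<lambda>x. l *\<^sub>R x - A x) D UNIV" "bounded_linear (resolvent D A l)"
    by (auto simp: resolvent_set_def)
  define R where "R = resolvent D A l"
  have R1: "R (l *\<^sub>R x - A x) = x" if "x \<in> D" for x
    unfolding R_def resolvent_def using bij_betw_inv_into_left[OF l(1) that] .
  have R2: "R y \<in> D" "l *\<^sub>R R y - A (R y) = y" for y
    unfolding R_def resolvent_def
    using bij_betw_apply[OF bij_betw_inv_into[OF l(1)], of y] bij_betw_inv_into_right[OF l(1), of y] by simp_all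
  \<comment> \<open>Membership in the domain and the value of \<open>A\<close> are encoded together
    in one equation for the bounded operator \<open>R\<close>; this is what translates integrated
    solutions into \<open>mild\<close>.\<close>
  have graph: "x \<in> D \<and> A x = y \<longleftrightarrow> x = R (l *\<^sub>R x - y)" for x y
  proof
    assume x: "x = R (l *\<^sub>R x - y)"
    then have "x \<in> D" "l *\<^sub>R x - A x = l *\<^sub>R x - y" using R2[of "l *\<^sub>R x - y"] by auto
    then show "x \<in> D \<and> A x = y" by simp
  qed (use R1 in auto)

  obtain \<beta> where b_le: "\<And>t. b t \<le> \<beta>" using assms(5) by (auto simp: bdd_above_def)
  have pert: "B t \<in> bounded_operators (closure D) UNIV" "0 \<le> b t" "opnorm_le (closure D) (B t) (b t)"
    "x \<in> closure D \<Longrightarrow> continuous_on UNIV (\<lambda>t. B t x)" for t x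
    using assms(4) by (auto simp: perturbation_condition_def)
  have \<beta>: "0 \<le> \<beta>" using pert(2) b_le order_trans by blast
  have X0: "subspace (closure D)" using A(1) by (rule subspace_closure)
  interpret E: integrated_equation R l "closure D" B \<beta>
  proof (rule integrated_equation.intro)
    show "bounded_linear R" using l(2) by (simp add: R_def)
    show "norm (B t x) \<le> \<beta> * norm x" if "x \<in> closure D" for t x
      using pert(3)[of t] that mult_right_mono[OF b_le[of t] norm_ge_zero[of x]]
      by (force simp: opnorm_le_def)
  qed (use X0 \<beta> pert bounded_operatorsD[OF pert(1)] in auto)
  have mild_iff: "E.mild s t u g \<longleftrightarrow>
      integral {s..t} u \<in> D \<and> u t = u s + A (integral {s..t} u) + integral {s..t} g" for s t u g
    using graph[of "integral {s..t} u" "u t - u s - integral {s..t} g"]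
    unfolding E.mild_def by (auto simp: algebra_simps)
  have from_iff: "integrated_solution_from D A B (\<lambda>_. 0) s x u \<longleftrightarrow> E.sol {s..} (\<lambda>_. 0) u \<and> u s = x" for s x u
  proof
    assume u: "integrated_solution_from D A B (\<lambda>_. 0) s x u"
    show "E.sol {s..} (\<lambda>_. 0) u \<and> u s = x"
    proof
      show "E.sol {s..} (\<lambda>_. 0) u"
      proof (rule E.sol_startI)
        show "E.mild s t u (\<lambda>r. B r (u r) + 0)" if "t \<in> {s..}" for t
          using u that unfolding mild_iff by (simp add: integrated_solution_from_def integrated_relations_def)
      qed (use u in \<open>simp_all add: integrated_solution_from_def is_interval_ci\<close>)
    qed (use u in \<open>simp add: integrated_solution_from_def\<close>)
  next
    assume u: "E.sol {s..} (\<lambda>_. 0) u \<and> u s = x"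
    then have "E.mild s t u (\<lambda>r. B r (u r) + 0)" if "t \<ge> s" for t
      using E.solD(5)[of "{s..}" "\<lambda>_. 0" u s t] that by simp
    then show "integrated_solution_from D A B (\<lambda>_. 0) s x u"
      using u unfolding mild_iff by (simp add: integrated_solution_from_def integrated_relations_def E.sol_def)
  qed
  have sol_iff: "integrated_solution D A B f u \<longleftrightarrow> E.sol UNIV f u" if "f \<in> bcontfun" for f u
    using that by (simp add: integrated_solution_def integrated_relations_def E.sol_def mild_iff
        is_interval_univ bcontfun_def)

  obtain \<delta> :: "real \<Rightarrow> real" where \<delta>: "mono_on {0..} \<delta>" "\<And>t. t \<ge> 0 \<Longrightarrow> 0 \<le> \<delta> t" "(\<delta> \<longlongrightarrow> 0) (at_right 0)"
    and force: "\<And>\<tau> f. 0 < \<tau> \<Longrightarrow> continuous_on {0..\<tau>} f \<Longrightarrow>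
      \<exists>u. continuous_on {0..\<tau>} u \<and> u ` {0..\<tau>} \<subseteq> closure D \<and>
        (\<forall>t\<in>{0..\<tau>}. integral {0..t} u \<in> D \<and> u t = A (integral {0..t} u) + integral {0..t} f \<and>
          norm (u t) \<le> \<delta> t * (SUP s\<in>{0..t}. norm (f s)))"
    using assms(3) unfolding forcing_condition_def by blast
  have "\<forall>\<^sub>F t in at_right 0. \<delta> t < 1 / (2 * (\<beta> + 1))"
    using \<beta> by (intro order_tendstoD(2)[OF \<delta>(3)]) simp
  then obtain h0 where "h0 > 0" "\<And>t. 0 < t \<Longrightarrow> t < h0 \<Longrightarrow> \<delta> t < 1 / (2 * (\<beta> + 1))"
    by (auto simp: eventually_at_right[OF zero_less_one])
  \<comment> \<open>The threshold contains \<open>\<beta> + 1\<close> instead of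
    \<open>\<beta>\<close> to allow \<open>\<beta> = 0\<close>; it gives the contraction factor one
    half required of \<open>q = \<delta> h\<close>.\<close>
  then obtain h where h: "0 < h" "\<delta> h < 1 / (2 * (\<beta> + 1))" using dense by blast
  have q: "0 \<le> \<delta> h" "\<delta> h * \<beta> \<le> 1 / 2"
  proof -
    show "0 \<le> \<delta> h" using \<delta>(2) h(1) by simp
    have "\<delta> h * \<beta> \<le> 1 / (2 * (\<beta> + 1)) * \<beta>" using h \<beta> by (intro mult_right_mono) auto
    also have "\<dots> \<le> 1 / 2" using \<beta> by (simp add: field_simps)
    finally show "\<delta> h * \<beta> \<le> 1 / 2" .
  qed
  have U: "evolution_family (closure D) U_B"
    "\<And>s x. x \<in> closure D \<Longrightarrow> E.sol {s..} (\<lambda>_. 0) (\<lambda>t. U_B t s x)"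
    "\<And>s x v t. x \<in> closure D \<Longrightarrow> E.sol {s..} (\<lambda>_. 0) v \<Longrightarrow> v s = x \<Longrightarrow> s \<le> t \<Longrightarrow> v t = U_B t s x"
    using assms(6) unfolding is_evolution_family_of_def from_iff by blast+
  interpret perturbed_family R l "closure D" B \<beta> h "\<delta> h" U_B
  proof
    fix g :: "real \<Rightarrow> 'a" and M
    assume g: "continuous_on {0..h} g" "\<And>s. s \<in> {0..h} \<Longrightarrow> norm (g s) \<le> M"
    obtain u where u: "continuous_on {0..h} u" "u ` {0..h} \<subseteq> closure D"
      "\<And>t. t \<in> {0..h} \<Longrightarrow> integral {0..t} u \<in> D"
      "\<And>t. t \<in> {0..h} \<Longrightarrow> u t = A (integral {0..t} u) + integral {0..t} g"
      "\<And>t. t \<in> {0..h} \<Longrightarrow> norm (u t) \<le> \<delta> t * (SUP s\<in>{0..t}. norm (g s))"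
      using force[OF h(1) g(1)] by metis
    have u0: "u 0 = 0" using u(4)[of 0] h(1) A0 by simp
    \<comment> \<open>Monotonicity of \<open>\<delta>\<close> replaces the factor
      \<open>\<delta> t\<close> by the single constant \<open>\<delta> h\<close> on the whole
      interval.\<close>
    have "E.mild 0 t u g \<and> norm (u t) \<le> \<delta> h * M" if t: "t \<in> {0..h}" for t
    proof
      show "E.mild 0 t u g" unfolding mild_iff using u(3,4)[OF t] u0 by simp
      have "0 \<le> M" using order_trans[OF norm_ge_zero g(2)[of 0]] h by simp
      have "norm (u t) \<le> \<delta> t * (SUP s\<in>{0..t}. norm (g s))" by (rule u(5)[OF t])
      also have "\<dots> \<le> \<delta> t * M"
        using t g(2) by (intro mult_left_mono cSUP_least \<delta>(2)) auto
      also have "\<dots> \<le> \<delta> h * M"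
        using t \<open>0 \<le> M\<close> by (intro mult_right_mono mono_onD[OF \<delta>(1)]) auto
      finally show "norm (u t) \<le> \<delta> h * M" .
    qed
    then show "\<exists>u. continuous_on {0..h} u \<and> u ` {0..h} \<subseteq> closure D \<and> u 0 = 0 \<and>
        (\<forall>t\<in>{0..h}. E.mild 0 t u g \<and> norm (u t) \<le> \<delta> h * M)"
      using u(1,2) u0 by blast
  qed (use h(1) q U in auto)
  have "has_exponential_dichotomy (closure D) U_B \<longleftrightarrow>
      (\<forall>f \<in> (bcontfun :: (real \<Rightarrow> 'a) set). \<exists>!u. u \<in> bcontfun \<and> E.sol UNIV f u)"
  proof
    assume "has_exponential_dichotomy (closure D) U_B"
    then obtain \<kappa> \<eta> where "exponential_dichotomy_with (closure D) U_B \<kappa> \<eta>" "\<kappa> \<ge> 1" "\<eta> > 0"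
      unfolding has_exponential_dichotomy_def by blast
    then show "\<forall>f \<in> (bcontfun :: (real \<Rightarrow> 'a) set). \<exists>!u. u \<in> bcontfun \<and> E.sol UNIV f u"
      using dichotomy_imp_admissible by blast
  next
    assume "\<forall>f \<in> (bcontfun :: (real \<Rightarrow> 'a) set). \<exists>!u. u \<in> bcontfun \<and> E.sol UNIV f u"
    then interpret admissible_family R l "closure D" B \<beta> h "\<delta> h" U_B
      by unfold_locales blast
    show "has_exponential_dichotomy (closure D) U_B" by (rule admissible_imp_dichotomy)
  qed
  then show ?thesis using sol_iff by (metis (no_types, lifting))
qed

end
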